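(* For every partition $\lambda$ of $n$, every composition $\beta$ of $n$, and $N\ge n$, the coefficient of $G_\beta(x_1,\ldots,x_N;t)$ in the expansion of $P_\lambda(x_1,\ldots,x_N;t)$ in the basis $\{G_\gamma\}$ is \[ \sum_{\substack{S\in\mathrm{SYT}(\lambda)\\ \mathrm{Des}(S)\subseteq\mathrm{sub}(\beta)}}\ \prod_{\substack{j\in\mathrm{sub}(\beta):\\ c_{j+1}\in\mathrm{espec}(S)}}\bigl(t^{m_j}-t^{\mathrm{wt}(c_{j+1})}\bigr)\prod_{j:\ c_{j+1}\in\mathrm{spec}(S)\setminus\mathrm{espec}(S)} t^{m'_j}\bigl(1-t^{\mathrm{wt}(c_{j+1})}\bigr). \]
   Context: $\mathrm{SYT}(\lambda)$ is the set of standard Young tableaux $S$ of shape $\lambda$ (English convention, cells $(i,j)$ in matrix coordinates); $c_k=c_k(S)$ is the cell containing $k$. $\mathrm{Des}(S)$ is the set of $k<n$ such that $k+1$ is in a lower row than $k$. $\mathrm{spec}(S)$ is the set of cells of $S$ not in column 1; for $(i,j)\in\mathrm{spec}(S)$, $\mathrm{wt}((i,j))=|\{(u,j-1)\in\lambda: u\ge i,\ S((u,j-1))<S((i,j))\}|$. For $E\subseteq\mathrm{spec}(S)$, $\mathrm{Asc}((S,E))$ is the set of $k<n$ such that either $k+1$ is in a lower row than $k$, or $k+1$ lies in a cell of $E$ in the column immediately to the right of the column containing $k$. $\mathrm{espec}(S)=\{c\in\mathrm{spec}(S):\mathrm{Asc}((S,\{c\}))\ne\mathrm{Asc}((S,\emptyset))\}$.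 For a composition $\beta$ of $n$, $\mathrm{sub}(\beta)$ is its set of proper partial sums $\{\beta_1,\beta_1+\beta_2,\ldots\}\subseteq[n-1]$; for $j\in[n-1]$, $m_j$ is the number of elements of $\mathrm{sub}(\beta)$ that are $\le j$, and $m'_j=m_j$ if $j\in\mathrm{sub}(\beta)\setminus\mathrm{Des}(S)$, $m'_j=0$ otherwise. $P_\lambda(x_1,\ldots,x_N;t)$ is the Hall–Littlewood polynomial, $P_\lambda=\sum_T\prod_{c}(1-t^{\mathrm{wt}_T(c)})x^T$ over semistandard tableaux $T$ of shape $\lambda$ with entries in $[N]$, the product over cells $(i,j)$, $j>1$, whose entry does not occur in column $j-1$, with $\mathrm{wt}_T((i,j))$ the number of cells $(u,j-1)$, $u\ge i$, with entry less than $T((i,j))$. $F_\alpha(x_1,\ldots,x_N)=\sum x_{w_1}\cdots x_{w_n}$ over $1\le w_1\le\cdots\le w_n\le N$ with $w_j<w_{j+1}$ for $j\in\mathrm{sub}(\alpha)$. For compositions with $\mathrm{sub}(\alpha)\subseteq\mathrm{sub}(\gamma)$ (written $\gamma\succeq\alpha$), writing $\alpha_j=\gamma_{i_{j-1}+1}+\dots+\gamma_{i_j}$ with $0=i_0<\dots<i_k=\ell(\gamma)$, let $s(\alpha,\gamma)=\sum_j j(i_j-i_{j-1}-1)$; Hivert's quasisymmetric Hall–Littlewood polynomials are $G_\alpha(x_1,\ldots,x_N;t)=\sum_{\gamma\succeq\alpha}(-1)^{\ell(\gamma)-\ell(\alpha)}t^{s(\alpha,\gamma)}F_\gamma$. 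*)

theory Defs
  imports
    "HOL-Library.FuncSet"
    "HOL-Library.Poly_Mapping"
    "HOL-Computational_Algebra.Polynomial"
begin

section \<open>Partitions and compositions\<close>

definition is_partition :: "nat list \<Rightarrow> nat \<Rightarrow> bool" where
  "is_partition lam n \<longleftrightarrow> sorted_wrt (\<ge>) lam \<and> (\<forall>a\<in>set lam. 0 < a) \<and> sum_list lam = n"

definition compositions :: "nat \<Rightarrow> nat list set" where
  "compositions n = {alpha. (\<forall>a\<in>set alpha. 0 < a) \<and> sum_list alpha = n}"

definition sub :: "nat list \<Rightarrow> nat set" where
  "sub alpha = {sum_list (take k alpha) | k. 1 \<le> k \<and> k < length alpha}"

section \<open>Tableaux\<close>

text \<open>Rows, columns and the parts of a partition are numbered from 1, as in matrices; lists are
  indexed from 0, hence the shift. A tableau is a function on cells that is \<^const>\<open>undefined\<close>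
  outside the shape.\<close>

definition cells :: "nat list \<Rightarrow> (nat \<times> nat) set" where
  "cells lam = {(i, j). 1 \<le> i \<and> i \<le> length lam \<and> 1 \<le> j \<and> j \<le> lam ! (i - 1)}"

definition SSYT :: "nat list \<Rightarrow> nat \<Rightarrow> (nat \<times> nat \<Rightarrow> nat) set" where
  "SSYT lam N = {T \<in> cells lam \<rightarrow>\<^sub>E {1..N}.
     (\<forall>i j j'. (i, j) \<in> cells lam \<and> (i, j') \<in> cells lam \<and> j < j' \<longrightarrow> T (i, j) \<le> T (i, j')) \<and>
     (\<forall>i i' j. (i, j) \<in> cells lam \<and> (i', j) \<in> cells lam \<and> i < i' \<longrightarrow> T (i, j) < T (i', j))}"

definition SYT :: "nat list \<Rightarrow> (nat \<times> nat \<Rightarrow> nat) set" where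
  "SYT lam = {S \<in> cells lam \<rightarrow>\<^sub>E {1..sum_list lam}.
     bij_betw S (cells lam) {1..sum_list lam} \<and>
     (\<forall>i j j'. (i, j) \<in> cells lam \<and> (i, j') \<in> cells lam \<and> j < j' \<longrightarrow> S (i, j) < S (i, j')) \<and>
     (\<forall>i i' j. (i, j) \<in> cells lam \<and> (i', j) \<in> cells lam \<and> i < i' \<longrightarrow> S (i, j) < S (i', j))}"

definition cell_of :: "nat list \<Rightarrow> (nat \<times> nat \<Rightarrow> nat) \<Rightarrow> nat \<Rightarrow> nat \<times> nat" where
  "cell_of lam S k = inv_into (cells lam) S k"

definition Des :: "nat list \<Rightarrow> (nat \<times> nat \<Rightarrow> nat) \<Rightarrow> nat set" where
  "Des lam S = {k \<in> {1..<sum_list lam}. fst (cell_of lam S k) < fst (cell_of lam S (k + 1))}"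

text \<open>The set of special cells of a standard tableau depends only on its shape.\<close>

definition spec :: "nat list \<Rightarrow> (nat \<times> nat) set" where
  "spec lam = {c \<in> cells lam. snd c \<noteq> 1}"

definition wt :: "nat list \<Rightarrow> (nat \<times> nat \<Rightarrow> nat) \<Rightarrow> nat \<times> nat \<Rightarrow> nat" where
  "wt lam T = (\<lambda>(i, j). card {(u, v) \<in> cells lam. v = j - 1 \<and> i \<le> u \<and> T (u, v) < T (i, j)})"

definition Asc ::
    "nat list \<Rightarrow> (nat \<times> nat \<Rightarrow> nat) \<Rightarrow> (nat \<times> nat) set \<Rightarrow> nat set" where
  "Asc lam S E = {k \<in> {1..<sum_list lam}.
     fst (cell_of lam S k) < fst (cell_of lam S (k + 1)) \<or>
     (cell_of lam S (k + 1) \<in> E \<and>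
      snd (cell_of lam S (k + 1)) = snd (cell_of lam S k) + 1)}"

definition espec :: "nat list \<Rightarrow> (nat \<times> nat \<Rightarrow> nat) \<Rightarrow> (nat \<times> nat) set" where
  "espec lam S = {c \<in> spec lam. Asc lam S {c} \<noteq> Asc lam S {}}"

definition mj :: "nat list \<Rightarrow> nat \<Rightarrow> nat" where
  "mj beta j = card {i \<in> sub beta. i \<le> j}"

definition mj' :: "nat list \<Rightarrow> nat list \<Rightarrow> (nat \<times> nat \<Rightarrow> nat) \<Rightarrow> nat \<Rightarrow> nat" where
  "mj' beta lam S j = (if j \<in> sub beta - Des lam S then mj beta j else 0)"

section \<open>Polynomials over the integer polynomials in one parameter\<close>

text \<open>Exponent vectors are finitely supported functions; the variable with index \<open>i\<close> occurs in
  the polynomials below only for \<open>1 \<le> i \<le> N\<close>.\<close>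

type_synonym mpoly_t = "(nat \<Rightarrow>\<^sub>0 nat) \<Rightarrow>\<^sub>0 int poly"

definition tvar :: "int poly" where
  "tvar = [:0, 1:]"

definition xvar :: "nat \<Rightarrow> mpoly_t" where
  "xvar i = Poly_Mapping.single (Poly_Mapping.single i 1) 1"

definition mscale :: "int poly \<Rightarrow> mpoly_t \<Rightarrow> mpoly_t" where
  "mscale a p = Poly_Mapping.single 0 a * p"

interpretation mpoly_t: module mscale
  by unfold_locales
    (simp_all add: mscale_def algebra_simps single_add mult_single flip: mult.assoc)

section \<open>Hall--Littlewood polynomials and their quasisymmetric analogues\<close>

definition hall_littlewood_P :: "nat \<Rightarrow> nat list \<Rightarrow> mpoly_t" where
  "hall_littlewood_P N lam =
     (\<Sum>T\<in>SSYT lam N.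
        mscale
          (\<Prod>c\<in>{(i, j) \<in> cells lam. 1 < j \<and> (\<forall>u. (u, j - 1) \<in> cells lam \<longrightarrow> T (u, j - 1) \<noteq> T (i, j))}.
             1 - tvar ^ wt lam T c)
          (\<Prod>c\<in>cells lam. xvar (T c)))"

definition fundamental_F :: "nat \<Rightarrow> nat list \<Rightarrow> mpoly_t" where
  "fundamental_F N alpha =
     (\<Sum>w\<in>{w. length w = sum_list alpha \<and> set w \<subseteq> {1..N} \<and> sorted w \<and>
             (\<forall>j\<in>sub alpha. w ! (j - 1) < w ! j)}.
        prod_list (map xvar w))"

text \<open>For compositions with \<open>sub \<alpha> \<subseteq> sub \<gamma>\<close>, the values of such an \<open>i\<close> on
  \<open>{0..length \<alpha>}\<close> exist and are uniquely determined.\<close>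

definition block_ends :: "nat list \<Rightarrow> nat list \<Rightarrow> (nat \<Rightarrow> nat) \<Rightarrow> bool" where
  "block_ends alpha gamma i \<longleftrightarrow>
     i 0 = 0 \<and> i (length alpha) = length gamma \<and>
     (\<forall>j\<in>{1..length alpha}.
        i (j - 1) < i j \<and> alpha ! (j - 1) = (\<Sum>l\<in>{i (j - 1) + 1..i j}. gamma ! (l - 1)))"

definition s_stat :: "nat list \<Rightarrow> nat list \<Rightarrow> nat" where
  "s_stat alpha gamma =
     (let i = (SOME i. block_ends alpha gamma i)
      in \<Sum>j\<in>{1..length alpha}. j * (i j - i (j - 1) - 1))"

definition hivert_G :: "nat \<Rightarrow> nat list \<Rightarrow> mpoly_t" where
  "hivert_G N alpha =
     (\<Sum>gamma\<in>{gamma \<in> compositions (sum_list alpha). sub alpha \<subseteq> sub gamma}.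
        mscale ((- 1) ^ (length gamma - length alpha) * tvar ^ s_stat alpha gamma)
          (fundamental_F N gamma))"

end

theory Submission
  imports Defs "HOL-Library.Multiset"
begin

text \<open>Standardization turns a semistandard tableau \<open>T\<close> into a standard tableau \<open>S\<close> together with
  the weakly increasing word \<open>w\<close> of its entries, where \<open>w\<close> must increase at every descent of \<open>S\<close>.
  The cells contributing a factor \<open>1 - t\<^bsup>wt\<^esup>\<close> to \<open>T\<close> are then the special cells of \<open>S\<close>
  except those cells \<open>c\<^bsub>j+1\<^esub>\<close> in \<open>espec S\<close> for which \<open>w\<close> does not increase at \<open>j\<close>. On the other
  side, \<open>G\<^sub>\<alpha>\<close> is the sum over the words \<open>w\<close> whose ascent set \<open>B\<close> contains \<open>A = sub \<alpha>\<close>, weighted by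
  the product of \<open>1 - t\<^bsup>m+1\<^esup>\<close> over \<open>c \<in> B - A\<close>, where \<open>m\<close> is the number of elements of \<open>A\<close>
  below \<open>c\<close>. Comparing coefficients of words, the theorem becomes an identity for each single \<open>S\<close>
  and \<open>B\<close>: a sum over the sets \<open>A\<close> with \<open>Des S \<subseteq> A \<subseteq> B\<close>. Deciding for the elements of \<open>B\<close> in
  increasing order whether they belong to \<open>A\<close>, the two choices at the next element contribute
  \<open>(1 - t\<^bsup>m+1\<^esup>) + (t\<^bsup>m+1\<^esup> - t\<^bsup>wt\<^esup>) = 1 - t\<^bsup>wt\<^esup>\<close> or \<open>(1 - t\<^bsup>m+1\<^esup>) + t\<^bsup>m+1\<^esup> = 1\<close>; since neither
  depends on \<open>m\<close>, and descents are always chosen with factor \<open>1\<close>, the sum factors.\<close>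

section \<open>Compositions and their partial sums\<close>

definition psum :: "nat list \<Rightarrow> nat \<Rightarrow> nat" where
  "psum alpha k = sum_list (take k alpha)"

lemma psum_0 [simp]: "psum alpha 0 = 0"
  by (simp add: psum_def)

lemma psum_length [simp]: "psum alpha (length alpha) = sum_list alpha"
  by (simp add: psum_def)

lemma psum_Suc: "k < length alpha \<Longrightarrow> psum alpha (Suc k) = psum alpha k + alpha ! k"
  by (simp add: psum_def take_Suc_conv_app_nth)

lemma psum_eq_sum: "k \<le> length alpha \<Longrightarrow> psum alpha k = (\<Sum>l\<in>{1..k}. alpha ! (l - 1))"
  by (induction k) (simp_all add: psum_Suc)

lemma psum_strict_mono:
  assumes "\<forall>a\<in>set alpha. 0 < a" "k < l" "l \<le> length alpha"
  shows "psum alpha k < psum alpha l"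
  using assms(2,3)
proof (induction l)
  case (Suc l)
  have "0 < alpha ! l" using Suc.prems assms(1) by auto
  moreover have "psum alpha k \<le> psum alpha l"
    using Suc by (cases "k = l") (auto simp: less_Suc_eq intro: less_imp_le)
  ultimately show ?case using Suc.prems by (simp add: psum_Suc)
qed simp

lemma psum_less_iff:
  assumes "\<forall>a\<in>set alpha. 0 < a" "k \<le> length alpha" "l \<le> length alpha"
  shows "psum alpha k < psum alpha l \<longleftrightarrow> k < l"
  using psum_strict_mono[OF assms(1)] assms(2,3) by (metis less_imp_not_less linorder_neqE_nat)

lemma psum_eq_iff:
  assumes "\<forall>a\<in>set alpha. 0 < a" "k \<le> length alpha" "l \<le> length alpha"
  shows "psum alpha k = psum alpha l \<longleftrightarrow> k = l"
  using psum_less_iff[OF assms] psum_less_iff[OF assms(1,3,2)]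
  by (metis linorder_neqE_nat nat_less_le)

lemma sub_eq_image: "sub alpha = psum alpha ` {1..<length alpha}"
  by (auto simp: sub_def psum_def image_iff)

lemma finite_sub [simp]: "finite (sub alpha)"
  by (simp add: sub_eq_image)

lemma compositions_pos: "alpha \<in> compositions n \<Longrightarrow> \<forall>a\<in>set alpha. 0 < a"
  by (simp add: compositions_def)

lemma compositions_sum: "alpha \<in> compositions n \<Longrightarrow> sum_list alpha = n"
  by (simp add: compositions_def)

lemma sub_subset:
  assumes "alpha \<in> compositions n"
  shows "sub alpha \<subseteq> {1..<n}"
proof
  fix x assume "x \<in> sub alpha"
  then obtain k where k: "1 \<le> k" "k < length alpha" "x = psum alpha k"
    by (auto simp: sub_eq_image)
  then show "x \<in> {1..<n}"
    using psum_strict_mono[OF compositions_pos[OF assms], of 0 k]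
      psum_strict_mono[OF compositions_pos[OF assms], of k "length alpha"]
      compositions_sum[OF assms] by auto
qed

lemma card_sub_less_psum:
  assumes "alpha \<in> compositions n" "j \<le> length alpha"
  shows "card {a \<in> sub alpha. a < psum alpha j} = j - 1"
proof -
  note pos = compositions_pos[OF assms(1)]
  have "{a \<in> sub alpha. a < psum alpha j} = psum alpha ` {1..<j}"
    using psum_less_iff[OF pos] assms(2) by (auto simp: sub_eq_image)
  moreover have "inj_on (psum alpha) {1..<j}"
    using psum_eq_iff[OF pos] assms(2) by (auto simp: inj_on_def)
  ultimately show ?thesis by (simp add: card_image)
qed

lemma card_sub:
  assumes "alpha \<in> compositions n"
  shows "card (sub alpha) = length alpha - 1"
proof -
  have "inj_on (psum alpha) {1..<length alpha}"
    using psum_eq_iff[OF compositions_pos[OF assms]] by (auto simp: inj_on_def)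
  then show ?thesis by (simp add: sub_eq_image card_image)
qed

lemma compositions_length_pos:
  assumes "alpha \<in> compositions n" "0 < n"
  shows "0 < length alpha"
  using assms by (auto simp: compositions_def)

lemma compositions_0: "compositions 0 = {[]}"
  by (auto simp: compositions_def) (metis list.set_intros(1) neq_Nil_conv sum_list_eq_0_iff less_numeral_extra(3))

lemma length_eq_Suc_card_sub:
  assumes "alpha \<in> compositions n" "0 < n"
  shows "length alpha = Suc (card (sub alpha))"
  using card_sub[OF assms(1)] compositions_length_pos[OF assms] by simp

text \<open>As the parts are positive, the inner partial sums enumerate \<open>sub\<close> in
  increasing order. The set and the total \<open>n\<close> thus determine all partial sums, whose
  differences are the parts.\<close>

lemma inj_on_sub: "inj_on sub (compositions n)"
proof (rule inj_onI)
  fix a b assume a: "a \<in> compositions n" and b: "b \<in> compositions n" and eq: "sub a = sub b"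
  show "a = b"
  proof (cases "n = 0")
    \<comment> \<open>For \<open>n = 0\<close> the only composition is empty, and its length is not
      \<open>Suc (card (sub a))\<close>.\<close>
    case True then show ?thesis using a b by (simp add: compositions_0)
  next
    case False
    then have len: "length a = length b"
      using length_eq_Suc_card_sub a b eq by (metis neq0_conv)
    have *: "psum x k = sorted_list_of_set (sub x) ! (k - 1)"
      if x: "x \<in> compositions n" and k: "1 \<le> k" "k < length x" for x k
    proof -
      let ?l = "map (psum x) [1..<length x]"
      have "sorted_wrt (<) ?l"
        using psum_strict_mono[OF compositions_pos[OF x]]
        by (auto simp: sorted_wrt_iff_nth_less)
      moreover have "set ?l = sub x" by (auto simp: sub_eq_image)
      ultimately have "?l = sorted_list_of_set (sub x)"
        by (metis sorted_list_of_set.idem_if_sorted_distinct strict_sorted_iff)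
      moreover have "?l ! (k - 1) = psum x k" using k by simp
      ultimately show ?thesis by simp
    qed
    have ps: "psum a k = psum b k" if k: "k \<le> length a" for k
    proof -
      consider "k = 0" | "k = length a" | "1 \<le> k" "k < length a"
        using k by linarith
      then show ?thesis
      proof cases
        case 2
        then show ?thesis using len compositions_sum[OF a] compositions_sum[OF b] psum_length
          by metis
      next
        case 3
        then show ?thesis using *[OF a] *[OF b] eq len by simp
      qed simp
    qed
    show ?thesis
    proof (rule nth_equalityI[OF len])
      fix i assume "i < length a"
      then show "a ! i = b ! i"
        using ps[of i] ps[of "Suc i"] len by (simp add: psum_Suc)
    qed
  qed
qed

lemma sub_append_single:
  assumes "a \<noteq> []"
  shows "sub (a @ [x]) = insert (sum_list a) (sub a)"
proof -
  have "{1..<length (a @ [x])} = insert (length a) {1..<length a}" using assms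
    by (auto simp: Suc_le_eq)
  then show ?thesis by (auto simp: sub_eq_image psum_def)
qed

text \<open>The largest element \<open>b\<close> becomes the last inner partial sum: a composition
  of \<open>b\<close> realizes the smaller elements, and the part \<open>n - b\<close> is appended.
  The induction therefore needs \<open>n\<close> arbitrary.\<close>

lemma sub_surj:
  assumes "A \<subseteq> {1..<n}" 
  shows "\<exists>alpha\<in>compositions n. sub alpha = A"
proof -
  have "finite A" using assms finite_subset by blast
  then show ?thesis using assms
  proof (induction A arbitrary: n rule: finite_linorder_max_induct)
    case empty
    show ?case
    proof (cases "n = 0")
      case True then show ?thesis by (auto simp: compositions_0 sub_def)
    next
      case False
      then have "[n] \<in> compositions n" by (simp add: compositions_def)
      moreover have "sub [n] = {}" by (auto simp: sub_def)
      ultimately show ?thesis by blast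
    qed
  next
    case (insert b A)
    then have b: "1 \<le> b" "b < n" by auto
    have "A \<subseteq> {1..<b}" using insert by auto
    then obtain alpha where alpha: "alpha \<in> compositions b" "sub alpha = A"
      using insert.IH by blast
    have "alpha @ [n - b] \<in> compositions n" using alpha b by (auto simp: compositions_def)
    moreover have "sub (alpha @ [n - b]) = insert b A"
      using sub_append_single[of alpha] compositions_length_pos[OF alpha(1)] alpha b
        compositions_sum[OF alpha(1)] by simp
    ultimately show ?case by blast
  qed
qed

lemma bij_betw_sub: "bij_betw sub (compositions n) (Pow {1..<n})"
  unfolding bij_betw_def
proof
  show "sub ` compositions n = Pow {1..<n}"
  proof
    show "sub ` compositions n \<subseteq> Pow {1..<n}" using sub_subset by blast
    show "Pow {1..<n} \<subseteq> sub ` compositions n" using sub_surj by (metis PowD imageI subsetI)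
  qed
qed (rule inj_on_sub)

lemma finite_compositions [simp]: "finite (compositions n)"
  using bij_betw_finite[OF bij_betw_sub] by simp

section \<open>Refinements of compositions and the statistic \<open>s_stat\<close>\<close>

lemma block_ends_psum:
  assumes "block_ends alpha gamma i" "j \<le> length alpha"
  shows "i j \<le> length gamma \<and> psum gamma (i j) = psum alpha j"
proof -
  have mono: "i k < i (Suc k)" if "k < length alpha" for k
    using assms(1) that unfolding block_ends_def by (auto dest!: bspec[of _ _ "Suc k"])
  have le: "i j \<le> length gamma" if "j \<le> length alpha" for j
  proof -
    have "i j \<le> i (length alpha)" using that
      by (induction rule: inc_induct) (use mono in \<open>auto intro: order_trans less_imp_le\<close>)
    then show ?thesis using assms(1) by (simp add: block_ends_def)
  qed
  show ?thesis using assms(2)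
  proof (induction j)
    case 0
    then show ?case using assms(1) by (simp add: block_ends_def)
  next
    case (Suc j)
    have "alpha ! j = (\<Sum>l\<in>{i j + 1..i (Suc j)}. gamma ! (l - 1))"
      using assms(1) Suc.prems unfolding block_ends_def by (auto dest!: bspec[of _ _ "Suc j"])
    moreover have "{1..i (Suc j)} = {1..i j} \<union> {i j + 1..i (Suc j)}"
      using mono[of j] Suc.prems by auto
    then have "(\<Sum>l\<in>{1..i (Suc j)}. gamma ! (l - 1)) =
        (\<Sum>l\<in>{1..i j}. gamma ! (l - 1)) + (\<Sum>l\<in>{i j + 1..i (Suc j)}. gamma ! (l - 1))"
      by (simp add: sum.union_disjoint)
    moreover have "psum gamma (i j) = psum alpha j" "i j \<le> length gamma" using Suc by auto
    ultimately show ?case using Suc.prems le[of "Suc j"]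
      by (simp only: psum_Suc[of j alpha] psum_eq_sum[of _ gamma] Suc_le_eq)
  qed
qed

text \<open>Each partial sum of \<open>alpha\<close>, including the trivial ones \<open>0\<close>
  and \<open>n\<close>, is a partial sum of \<open>gamma\<close>; \<open>i j\<close> is its position
  there.\<close>

lemma block_ends_exists:
  assumes a: "alpha \<in> compositions n" and g: "gamma \<in> compositions n" and "sub alpha \<subseteq> sub gamma"
  shows "\<exists>i. block_ends alpha gamma i"
proof -
  note pos = compositions_pos[OF a] compositions_pos[OF g]
  have "\<exists>k\<le>length gamma. psum gamma k = psum alpha j" if j: "j \<le> length alpha" for j
  proof -
    consider "j = 0" | "j = length alpha" | "1 \<le> j" "j < length alpha"
      using j by linarith
    then show ?thesis
    proof cases
      case 2
      then have "psum gamma (length gamma) = psum alpha j"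
        using compositions_sum[OF a] compositions_sum[OF g] by simp
      then show ?thesis by blast
    next
      case 3
      then have "psum alpha j \<in> sub gamma" using assms(3) by (auto simp: sub_eq_image)
      then obtain k where "k < length gamma" "psum gamma k = psum alpha j"
        unfolding sub_eq_image by fastforce
      then show ?thesis by (intro exI[of _ k]) simp
    qed force
  qed
  then obtain i where i: "\<And>j. j \<le> length alpha \<Longrightarrow> i j \<le> length gamma \<and> psum gamma (i j) = psum alpha j"
    by metis
  have "i 0 = 0" using i[of 0] psum_eq_iff[OF pos(2), of "i 0" 0] by simp
  moreover have "i (length alpha) = length gamma"
    using i[of "length alpha"] psum_eq_iff[OF pos(2), of "i (length alpha)" "length gamma"]
      compositions_sum[OF a] compositions_sum[OF g] by simp
  moreover have "i (j - 1) < i j \<and> alpha ! (j - 1) = (\<Sum>l\<in>{i (j - 1) + 1..i j}. gamma ! (l - 1))"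
    if j: "j \<in> {1..length alpha}" for j
  proof -
    have less: "i (j - 1) < i j"
      using psum_less_iff[OF pos(2), of "i (j - 1)" "i j"] psum_less_iff[OF pos(1), of "j - 1" j]
        i[of j] i[of "j - 1"] j by auto
    have "psum alpha j = psum alpha (j - 1) + alpha ! (j - 1)"
      using psum_Suc[of "j - 1" alpha] j by auto
    moreover have "{1..i j} = {1..i (j - 1)} \<union> {i (j - 1) + 1..i j}" using less by auto
    then have "(\<Sum>l\<in>{1..i j}. gamma ! (l - 1)) =
        (\<Sum>l\<in>{1..i (j - 1)}. gamma ! (l - 1)) + (\<Sum>l\<in>{i (j - 1) + 1..i j}. gamma ! (l - 1))"
      by (simp add: sum.union_disjoint)
    ultimately show ?thesis
      using less i[of j] i[of "j - 1"] j le_trans[OF diff_le_self, of j "length alpha" 1] psum_eq_sum[of "i j" gamma] psum_eq_sum[of "i (j - 1)" gamma]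
      by auto
  qed
  ultimately show ?thesis unfolding block_ends_def by blast
qed

text \<open>Each cut of \<open>gamma\<close> strictly inside the \<open>j\<close>th block of
  \<open>alpha\<close> counts \<open>j\<close>, and exactly \<open>j - 1\<close> elements of
  \<open>sub alpha\<close> lie below it. This replaces the choice in \<open>s_stat\<close> by data
  of the two sets.\<close>

lemma s_stat_eq:
  assumes a: "alpha \<in> compositions n" and g: "gamma \<in> compositions n" and "sub alpha \<subseteq> sub gamma"
  shows "s_stat alpha gamma = (\<Sum>c\<in>sub gamma - sub alpha. Suc (card {x \<in> sub alpha. x \<le> c}))"
proof -
  note pos = compositions_pos[OF a] compositions_pos[OF g]
  define i where "i = (SOME i. block_ends alpha gamma i)"
  have be: "block_ends alpha gamma i"
    unfolding i_def using block_ends_exists[OF assms] by (rule someI_ex)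
  have i: "i j \<le> length gamma" "psum gamma (i j) = psum alpha j" if "j \<le> length alpha" for j
    using block_ends_psum[OF be that] by auto
  have i_mono: "i j \<le> i k" if "j \<le> k" "k \<le> length alpha" for j k
    using psum_less_iff[OF pos(2) i(1) i(1), of k j] psum_less_iff[OF pos(1), of k j] i(2) that
    by force
  \<comment> \<open>The positions in \<open>gamma\<close> of the cuts strictly inside the
    \<open>j\<close>th block of \<open>alpha\<close>.\<close>
  let ?K = "\<lambda>j. {k. i (j - 1) < k \<and> k < i j}"
  let ?C = "\<lambda>j. psum gamma ` ?K j"
  have union: "sub gamma - sub alpha = (\<Union>j\<in>{1..length alpha}. ?C j)"
  proof (intro equalityI subsetI)
    fix c assume c: "c \<in> sub gamma - sub alpha"
    then obtain k where k: "1 \<le> k" "k < length gamma" "c = psum gamma k"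
      by (auto simp: sub_eq_image)
    \<comment> \<open>The block containing the cut is the first one that ends at or after
      it.\<close>
    define j where "j = (LEAST j. k \<le> i j)"
    have il: "i (length alpha) = length gamma" "i 0 = 0" using be by (auto simp: block_ends_def)
    have ex: "k \<le> i (length alpha)" using k il by simp
    have j: "k \<le> i j" unfolding j_def using ex by (rule LeastI)
    have jl: "j \<le> length alpha" unfolding j_def using ex by (rule Least_le)
    have j0: "1 \<le> j" using j il k by (cases "j = 0") auto
    have "j - 1 < j" using j0 by simp
    then have "\<not> k \<le> i (j - 1)" unfolding j_def by (rule not_less_Least)
    moreover have "k \<noteq> i j"
    proof
      assume "k = i j"
      moreover from this have "j < length alpha" using k jl il(1)
        by (metis le_neq_implies_less nat_less_le)
      ultimately have "c \<in> sub alpha" using k i(2)[OF jl] j0 by (auto simp: sub_eq_image)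
      then show False using c by simp
    qed
    ultimately have "k \<in> ?K j" using j by simp
    then show "c \<in> (\<Union>j\<in>{1..length alpha}. ?C j)" using k j0 jl by auto
  next
    fix c assume "c \<in> (\<Union>j\<in>{1..length alpha}. ?C j)"
    then obtain j k where jk: "1 \<le> j" "j \<le> length alpha" "i (j - 1) < k" "k < i j" "c = psum gamma k"
      by auto
    have kl: "k < length gamma" using jk i(1)[of j] by simp
    have "c \<in> sub gamma" using jk kl by (auto simp: sub_eq_image)
    moreover have "c \<notin> sub alpha"
    proof
      assume "c \<in> sub alpha"
      then obtain l where l: "1 \<le> l" "l < length alpha" "c = psum alpha l"
        by (auto simp: sub_eq_image)
      then have "k = i l" using psum_eq_iff[OF pos(2), of k "i l"] i[of l] jk kl by simp
      then have "i (j - 1) < i l" "i l < i j" using jk by auto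
      then have "j - 1 < l" "l < j" using i_mono jk l
        by (metis leD less_imp_le not_le_imp_less diff_le_self le_trans)+
      then show False by simp
    qed
    ultimately show "c \<in> sub gamma - sub alpha" by simp
  qed
  have finK: "finite (?K j)" for j by (rule finite_subset[of _ "{..i j}"]) auto
  have card_le: "Suc (card {x \<in> sub alpha. x \<le> c}) = j"
    if j: "j \<in> {1..length alpha}" and c: "c \<in> ?C j" for j c
  proof -
    from c obtain k where k: "i (j - 1) < k" "k < i j" "c = psum gamma k" by auto
    have 1: "psum alpha (j - 1) < c" "c < psum alpha j"
      using k j i[of j] i[of "j - 1"] psum_less_iff[OF pos(2), of "i (j - 1)" k]
        psum_less_iff[OF pos(2), of k "i j"] by auto
    have "x \<le> c \<longleftrightarrow> x < psum alpha j" if x: "x \<in> sub alpha" for x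
    proof -
      obtain l where l: "l < length alpha" "x = psum alpha l" using x by (auto simp: sub_eq_image)
      show ?thesis
      proof
        assume "x < psum alpha j"
        then have "l \<le> j - 1" using psum_less_iff[OF pos(1), of l j] l j by auto
        then have "x \<le> psum alpha (j - 1)"
          using psum_less_iff[OF pos(1), of "j - 1" l] l j
          by (metis atLeastAtMost_iff diff_le_self le_trans less_imp_le not_le)
        then show "x \<le> c" using 1 by simp
      qed (use 1 in simp)
    qed
    then have "{x \<in> sub alpha. x \<le> c} = {x \<in> sub alpha. x < psum alpha j}" by auto
    then show ?thesis using card_sub_less_psum[OF a, of j] j by simp
  qed
  \<comment> \<open>By \<open>card_le\<close> the block index can be read off from the cut
    itself.\<close>
  have disj: "?C j \<inter> ?C j' = {}" if "j \<in> {1..length alpha}" "j' \<in> {1..length alpha}" "j \<noteq> j'" for j j'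
    using card_le[OF that(1)] card_le[OF that(2)] that(3) by blast
  have inj: "inj_on (psum gamma) (?K j)" if "j \<in> {1..length alpha}" for j
    using psum_eq_iff[OF pos(2)] i(1)[of j] that by (auto simp: inj_on_def)
  have cardC: "card (?C j) = i j - i (j - 1) - 1" if "j \<in> {1..length alpha}" for j
  proof -
    have "?K j = {Suc (i (j - 1))..<i j}" by auto
    then show ?thesis using card_image[OF inj[OF that]] by simp
  qed
  have "(\<Sum>c\<in>sub gamma - sub alpha. Suc (card {x \<in> sub alpha. x \<le> c})) =
      (\<Sum>j\<in>{1..length alpha}. \<Sum>c\<in>?C j. Suc (card {x \<in> sub alpha. x \<le> c}))"
    unfolding union by (rule sum.UNION_disjoint) (use finK disj in auto)
  also have "\<dots> = (\<Sum>j\<in>{1..length alpha}. \<Sum>c\<in>?C j. j)"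
    using card_le by (intro sum.cong refl) auto
  also have "\<dots> = (\<Sum>j\<in>{1..length alpha}. j * (i j - i (j - 1) - 1))"
    using cardC by (intro sum.cong refl) simp
  finally show ?thesis unfolding s_stat_def i_def Let_def by simp
qed

section \<open>Sorted words as monomials\<close>

definition words :: "nat \<Rightarrow> nat \<Rightarrow> nat list set" where
  "words N n = {w. length w = n \<and> set w \<subseteq> {1..N} \<and> sorted w}"

definition ascents :: "nat list \<Rightarrow> nat set" where
  "ascents w = {j \<in> {1..<length w}. w ! (j - 1) < w ! j}"

definition word_exp :: "nat list \<Rightarrow> nat \<Rightarrow>\<^sub>0 nat" where
  "word_exp w = (\<Sum>i\<leftarrow>w. Poly_Mapping.single i 1)"

definition word_monom :: "nat list \<Rightarrow> mpoly_t" where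
  "word_monom w = prod_list (map xvar w)"

lemma finite_words [simp]: "finite (words N n)"
proof (rule finite_subset)
  show "words N n \<subseteq> {w. set w \<subseteq> {1..N} \<and> length w = n}" by (auto simp: words_def)
qed (simp add: finite_lists_length_eq)

lemma finite_ascents [simp]: "finite (ascents w)"
  by (simp add: ascents_def)

lemma ascents_subset: "w \<in> words N n \<Longrightarrow> ascents w \<subseteq> {1..<n}"
  by (auto simp: ascents_def words_def)

lemma word_monom_eq_single: "word_monom w = Poly_Mapping.single (word_exp w) 1"
proof (induction w)
  case Nil
  show ?case by (simp add: word_monom_def word_exp_def flip: single_one)
next
  case (Cons a w)
  then show ?case by (simp add: word_monom_def word_exp_def xvar_def mult_single)
qed

lemma lookup_word_exp: "Poly_Mapping.lookup (word_exp w) i = count_list w i"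
  by (induction w) (auto simp: word_exp_def lookup_add lookup_single)

text \<open>The exponent vector counts the letters, and a sorted word is determined by its multiset
  of letters.\<close>

lemma inj_on_word_exp: "inj_on word_exp (words N n)"
proof (rule inj_onI)
  fix v w assume v: "v \<in> words N n" and w: "w \<in> words N n" and "word_exp v = word_exp w"
  then have "count_list v i = count_list w i" for i by (metis lookup_word_exp)
  then have "mset v = mset w" by (intro multiset_eqI) (simp add: count_mset)
  then show "v = w" using v w
    by (metis (no_types, lifting) mem_Collect_eq properties_for_sort sort_key_id_if_sorted words_def)
qed

lemma lookup_mscale: "Poly_Mapping.lookup (mscale a p) x = a * Poly_Mapping.lookup p x"
  unfolding mscale_def by (simp add: lookup_mult lookup_single when_mult)

lemma lookup_word_sum:
  assumes "w \<in> words N n"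
  shows "Poly_Mapping.lookup (\<Sum>v\<in>words N n. mscale (h v) (word_monom v)) (word_exp w) = h w"
proof -
  have "Poly_Mapping.lookup (\<Sum>v\<in>words N n. mscale (h v) (word_monom v)) (word_exp w) =
      (\<Sum>v\<in>words N n. if v = w then h v else 0)"
    unfolding lookup_sum
    using inj_on_word_exp[of N n] assms
    by (intro sum.cong refl) (auto simp: lookup_mscale word_monom_eq_single lookup_single when_def inj_on_def)
  then show ?thesis using assms by simp
qed

text \<open>Take as letter at list index \<open>i\<close> one more than the number of elements of
  \<open>A\<close> up to \<open>i\<close>: the word then steps up exactly at \<open>A\<close>. No
  letter exceeds \<open>n\<close>, so \<open>n \<le> N\<close> provides enough letters.\<close>

lemma words_ascents_surj:
  assumes "A \<subseteq> {1..<n}" "n \<le> N"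
  shows "\<exists>w\<in>words N n. ascents w = A"
proof -
  have fin: "finite A" using assms(1) finite_subset by blast
  let ?f = "\<lambda>i. Suc (card {c \<in> A. c \<le> i})"
  let ?w = "map ?f [0..<n]"
  have mono: "?f i \<le> ?f j" if "i \<le> j" for i j
    using fin that by (auto intro!: card_mono)
  have "?f i \<le> N" if "i < n" for i
  proof -
    have "card {c \<in> A. c \<le> i} \<le> card {1..<n}" using assms(1) by (intro card_mono) auto
    then show ?thesis using that assms(2) by simp
  qed
  then have "?w \<in> words N n" using mono
    by (auto simp: words_def sorted_wrt_iff_nth_less sorted_iff_nth_mono_less)
  moreover have "ascents ?w = A"
  proof -
    have "?f (j - 1) < ?f j \<longleftrightarrow> j \<in> A" if j: "j \<in> {1..<n}" for j
    proof (cases "j \<in> A")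
      case True
      then have "{c \<in> A. c \<le> j} = insert j {c \<in> A. c \<le> j - 1}" using j by auto
      moreover have "j \<notin> {c \<in> A. c \<le> j - 1}" using j by auto
      ultimately show ?thesis using True fin by simp
    next
      case False
      then have "c \<le> j - 1 \<longleftrightarrow> c \<le> j" if "c \<in> A" for c
        using that j by (cases "c = j") auto
      then have "{c \<in> A. c \<le> j - 1} = {c \<in> A. c \<le> j}" by blast
      then show ?thesis using False by simp
    qed
    moreover have "?w ! (j - 1) = ?f (j - 1)" "?w ! j = ?f j" if "j \<in> {1..<n}" for j
      using that by auto
    ultimately have "ascents ?w = {j \<in> {1..<n}. j \<in> A}"
      unfolding ascents_def by (intro Collect_cong conj_cong) simp_all
    then show ?thesis using assms(1) by auto
  qed
  ultimately show ?thesis by blast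
qed

section \<open>Hivert's polynomials in terms of words\<close>

definition upto_card :: "nat set \<Rightarrow> nat \<Rightarrow> nat" where
  "upto_card A c = card {a \<in> A. a \<le> c}"

lemma mj_eq: "mj alpha c = upto_card (sub alpha) c"
  by (simp add: mj_def upto_card_def)

lemma fundamental_F_words:
  assumes "gamma \<in> compositions n"
  shows "fundamental_F N gamma = (\<Sum>w\<in>{w \<in> words N n. sub gamma \<subseteq> ascents w}. word_monom w)"
proof -
  have "{w. length w = sum_list gamma \<and> set w \<subseteq> {1..N} \<and> sorted w \<and> (\<forall>j\<in>sub gamma. w ! (j - 1) < w ! j)} =
      {w \<in> words N n. sub gamma \<subseteq> ascents w}"
    using sub_subset[OF assms] compositions_sum[OF assms] by (auto simp: words_def ascents_def)
  then show ?thesis by (simp add: fundamental_F_def word_monom_def)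
qed

text \<open>The coefficient of a word with ascent set \<open>B\<close> in
  \<open>hivert_G N alpha\<close>, where \<open>A = sub alpha\<close>. Phrasing it with sets lets
  compositions be traded for subsets of \<open>{1..<n}\<close>.\<close>

definition G_coeff :: "nat set \<Rightarrow> nat set \<Rightarrow> int poly" where
  "G_coeff A B = (if A \<subseteq> B then \<Prod>c\<in>B - A. 1 - tvar ^ Suc (upto_card A c) else 0)"

text \<open>Expanding the product selects a subset \<open>X\<close> of \<open>B - A\<close>, which
  corresponds to the set \<open>X \<union> A\<close>.\<close>

lemma sum_interval_prod:
  fixes f :: "'a \<Rightarrow> 'b :: comm_ring_1"
  assumes "finite B" "A \<subseteq> B"
  shows "(\<Sum>C | A \<subseteq> C \<and> C \<subseteq> B. \<Prod>c\<in>C - A. f c) = (\<Prod>c\<in>B - A. 1 + f c)"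
proof -
  have "(\<Prod>c\<in>B - A. f c + 1) = (\<Sum>X\<in>Pow (B - A). prod f X)"
    using assms by (subst prod_add) auto
  also have "\<dots> = (\<Sum>C | A \<subseteq> C \<and> C \<subseteq> B. \<Prod>c\<in>C - A. f c)"
    by (rule sum.reindex_bij_witness[of _ "\<lambda>C. C - A" "\<lambda>X. X \<union> A"])
      (use assms in \<open>auto intro!: arg_cong[where f = "prod f"]\<close>)
  finally show ?thesis by (simp add: add.commute)
qed

text \<open>By \<open>s_stat_eq\<close> the sign and power of \<open>t\<close> in front of
  \<open>fundamental_F N gamma\<close> split into one factor for each element of
  \<open>sub gamma - sub alpha\<close>. A word occurs in this polynomial iff its ascent set contains
  \<open>sub gamma\<close>, so its total coefficient is a sum over all sets between
  \<open>sub alpha\<close> and the ascent set, which \<open>sum_interval_prod\<close>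
  evaluates.\<close>

lemma hivert_G_words:
  assumes a: "alpha \<in> compositions n"
  shows "hivert_G N alpha = (\<Sum>w\<in>words N n. mscale (G_coeff (sub alpha) (ascents w)) (word_monom w))"
proof -
  let ?f = "\<lambda>c. - (tvar ^ Suc (upto_card (sub alpha) c))"
  let ?g = "\<lambda>C. \<Prod>c\<in>C - sub alpha. ?f c"
  let ?\<Gamma> = "{gamma \<in> compositions n. sub alpha \<subseteq> sub gamma}"
  have coef: "(- 1) ^ (length gamma - length alpha) * tvar ^ s_stat alpha gamma = ?g (sub gamma)"
    if g: "gamma \<in> ?\<Gamma>" for gamma
  proof -
    have gc: "gamma \<in> compositions n" and le: "sub alpha \<subseteq> sub gamma" using g by auto
    have "card (sub gamma - sub alpha) = card (sub gamma) - card (sub alpha)"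
      using le by (simp add: card_Diff_subset)
    also have "\<dots> = length gamma - length alpha"
    proof (cases "n = 0")
      case True
      then show ?thesis using a gc by (simp add: compositions_0)
    next
      case False
      then show ?thesis using length_eq_Suc_card_sub[OF a] length_eq_Suc_card_sub[OF gc] by simp
    qed
    finally show ?thesis
      by (simp add: prod_uminus s_stat_eq[OF a gc le] power_sum upto_card_def)
  qed
  have "hivert_G N alpha = (\<Sum>gamma\<in>?\<Gamma>. mscale (?g (sub gamma)) (fundamental_F N gamma))"
    unfolding hivert_G_def compositions_sum[OF a] by (intro sum.cong refl) (simp only: coef)
  also have "\<dots> = (\<Sum>gamma\<in>?\<Gamma>. \<Sum>w\<in>{w \<in> words N n. sub gamma \<subseteq> ascents w}.
      mscale (?g (sub gamma)) (word_monom w))"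
    by (intro sum.cong refl, subst fundamental_F_words[of _ n]) (simp, rule mpoly_t.scale_sum_right)
  also have "\<dots> = (\<Sum>w\<in>words N n. \<Sum>gamma\<in>{gamma \<in> ?\<Gamma>. sub gamma \<subseteq> ascents w}.
      mscale (?g (sub gamma)) (word_monom w))"
    by (rule sum.swap_restrict) auto
  also have "\<dots> = (\<Sum>w\<in>words N n. mscale (G_coeff (sub alpha) (ascents w)) (word_monom w))"
  proof (intro sum.cong refl)
    fix w assume w: "w \<in> words N n"
    have "(\<Sum>gamma\<in>{gamma \<in> ?\<Gamma>. sub gamma \<subseteq> ascents w}. ?g (sub gamma)) =
        (\<Sum>C | sub alpha \<subseteq> C \<and> C \<subseteq> ascents w. ?g C)"
    proof (rule sum.reindex_bij_betw)
      have "sub ` {gamma \<in> ?\<Gamma>. sub gamma \<subseteq> ascents w} = {C. sub alpha \<subseteq> C \<and> C \<subseteq> ascents w}"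
        using ascents_subset[OF w] sub_surj by (auto simp: image_iff) (metis order_trans)
      then show "bij_betw sub {gamma \<in> ?\<Gamma>. sub gamma \<subseteq> ascents w} {C. sub alpha \<subseteq> C \<and> C \<subseteq> ascents w}"
        using inj_on_subset[OF inj_on_sub, of _ n] by (simp add: bij_betw_def subset_iff)
    qed
    also have "\<dots> = G_coeff (sub alpha) (ascents w)"
    proof (cases "sub alpha \<subseteq> ascents w")
      case True
      then show ?thesis by (subst sum_interval_prod) (simp_all add: G_coeff_def)
    next
      case False
      then have "{C. sub alpha \<subseteq> C \<and> C \<subseteq> ascents w} = {}" by auto
      then show ?thesis using False by (simp only: G_coeff_def sum.empty if_False)
    qed
    finally show "(\<Sum>gamma\<in>{gamma \<in> ?\<Gamma>. sub gamma \<subseteq> ascents w}. mscale (?g (sub gamma)) (word_monom w)) =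
        mscale (G_coeff (sub alpha) (ascents w)) (word_monom w)"
      by (simp flip: mpoly_t.scale_sum_left)
  qed
  finally show ?thesis .
qed

section \<open>Linear independence of the polynomials \<open>hivert_G N gamma\<close>\<close>

lemma lookup_hivert_G:
  assumes "alpha \<in> compositions n" "w \<in> words N n"
  shows "Poly_Mapping.lookup (hivert_G N alpha) (word_exp w) = G_coeff (sub alpha) (ascents w)"
  by (simp add: hivert_G_words[OF assms(1)] lookup_word_sum[OF assms(2)])

text \<open>Triangularity: a word whose ascent set is exactly \<open>sub gamma\<close> receives
  contributions only from those \<open>delta\<close> with
  \<open>sub delta \<subseteq> sub gamma\<close>, and with coefficient 1 from \<open>gamma\<close>
  itself. Induction on the size of \<open>sub gamma\<close> removes the proper subsets.\<close>

lemma hivert_G_coeffs_zero: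
  assumes "n \<le> N" and zero: "(\<Sum>gamma\<in>compositions n. mscale (u gamma) (hivert_G N gamma)) = 0"
    and g: "gamma \<in> compositions n"
  shows "u gamma = 0"
  using g
proof (induction "card (sub gamma)" arbitrary: gamma rule: less_induct)
  case less
  obtain w where w: "w \<in> words N n" "ascents w = sub gamma"
    using words_ascents_surj[OF sub_subset[OF less.prems] assms(1)] by blast
  have "0 = Poly_Mapping.lookup (\<Sum>delta\<in>compositions n. mscale (u delta) (hivert_G N delta)) (word_exp w)"
    using zero by simp
  also have "\<dots> = (\<Sum>delta\<in>compositions n. u delta * G_coeff (sub delta) (sub gamma))"
    unfolding lookup_sum using lookup_hivert_G[OF _ w(1)] w(2)
      by (intro sum.cong refl) (simp add: lookup_mscale)
  also have "\<dots> = (\<Sum>delta\<in>compositions n. if delta = gamma then u gamma else 0)"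
  proof (intro sum.cong refl)
    fix delta assume d: "delta \<in> compositions n"
    show "u delta * G_coeff (sub delta) (sub gamma) = (if delta = gamma then u gamma else 0)"
    proof (cases "sub delta \<subset> sub gamma")
      case True
      then have "u delta = 0" using less.hyps[OF _ d] by (simp add: psubset_card_mono)
      then show ?thesis using True by auto
    next
      case False
      then show ?thesis using inj_onD[OF inj_on_sub _ d less.prems] by (auto simp: G_coeff_def)
    qed
  qed
  finally show ?case using less.prems by simp
qed

text \<open>\<open>independent\<close> and \<open>representation\<close> speak of a set of
  polynomials rather than of a family indexed by compositions; this lemma lets one pass between the
  two.\<close>

lemma inj_on_hivert_G:
  assumes "n \<le> N"
  shows "inj_on (hivert_G N) (compositions n)"
proof (rule inj_onI, rule ccontr)
  fix a b assume ab: "a \<in> compositions n" "b \<in> compositions n" "hivert_G N a = hivert_G N b" "a \<noteq> b"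
  \<comment> \<open>If the two polynomials agreed, the coefficients 1 at \<open>a\<close> and -1 at
    \<open>b\<close> would give a vanishing combination.\<close>
  let ?u = "\<lambda>g. if g = a then 1 else if g = b then - 1 else (0 :: int poly)"
  have "(\<Sum>g\<in>compositions n. mscale (?u g) (hivert_G N g)) = (\<Sum>g\<in>{a, b}. mscale (?u g) (hivert_G N g))"
    by (rule sum.mono_neutral_right) (use ab in auto)
  also have "\<dots> = 0" using ab by simp
  finally show False using hivert_G_coeffs_zero[OF assms _ ab(1), of ?u] by simp
qed

lemma independent_hivert_G:
  assumes "n \<le> N"
  shows "mpoly_t.independent (hivert_G N ` compositions n)"
proof (subst mpoly_t.independent_explicit_module, intro allI impI)
  fix t :: "mpoly_t set" and f :: "mpoly_t \<Rightarrow> int poly" and p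
  let ?B = "hivert_G N ` compositions n" and ?f = "\<lambda>v. if v \<in> t then f v else 0"
  assume t: "t \<subseteq> ?B" and zero: "(\<Sum>v\<in>t. mscale (f v) v) = 0" and p: "p \<in> t"
  then obtain g where g: "g \<in> compositions n" "p = hivert_G N g" by blast
  have "(\<Sum>v\<in>?B. mscale (?f v) v) = (\<Sum>v\<in>t. mscale (f v) v)"
    by (rule sum.mono_neutral_cong_right) (use t in auto)
  then have "(\<Sum>g\<in>compositions n. mscale (?f (hivert_G N g)) (hivert_G N g)) = 0"
    using zero by (simp add: sum.reindex[OF inj_on_hivert_G[OF assms]])
  from hivert_G_coeffs_zero[OF assms this g(1)] g(2) p show "f p = 0" by simp
qed

text \<open>Two expansions of \<open>p\<close> differ by a vanishing combination, all of whose
  coefficients are zero. So any explicit expansion can be read as a statement about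
  \<open>representation\<close>.\<close>

lemma representation_hivert_G:
  assumes "n \<le> N" "p = (\<Sum>gamma\<in>compositions n. mscale (u gamma) (hivert_G N gamma))"
  shows "p \<in> mpoly_t.span (hivert_G N ` compositions n)"
    and "beta \<in> compositions n \<Longrightarrow>
      mpoly_t.representation (hivert_G N ` compositions n) p (hivert_G N beta) = u beta"
proof -
  let ?B = "hivert_G N ` compositions n"
  show span: "p \<in> mpoly_t.span ?B"
    unfolding assms(2) by (intro mpoly_t.span_sum mpoly_t.span_scale mpoly_t.span_base) auto
  let ?r = "mpoly_t.representation ?B p"
  assume beta: "beta \<in> compositions n"
  have "p = (\<Sum>x\<in>?B. mscale (?r x) x)"
    by (rule mpoly_t.sum_representation_eq[symmetric]) (use independent_hivert_G[OF assms(1)] span in auto)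
  also have "\<dots> = (\<Sum>gamma\<in>compositions n. mscale (?r (hivert_G N gamma)) (hivert_G N gamma))"
    by (simp add: sum.reindex[OF inj_on_hivert_G[OF assms(1)]])
  finally have "(\<Sum>gamma\<in>compositions n. mscale (?r (hivert_G N gamma) - u gamma) (hivert_G N gamma)) = 0"
    using assms(2) by (simp add: mpoly_t.scale_left_diff_distrib sum_subtractf)
  from hivert_G_coeffs_zero[OF assms(1) this beta] show "?r (hivert_G N beta) = u beta" by simp
qed

section \<open>The coefficient identity\<close>

text \<open>The offset \<open>k\<close> counts the elements selected below \<open>B\<close>, so that the minimal element of
  \<open>B\<close> can be split off in an induction.\<close>

lemma sum_subsets_telescope:
  fixes r p :: "nat \<Rightarrow> nat \<Rightarrow> 'a :: comm_ring_1"
  assumes "finite B" and "\<And>b k. b \<in> B \<Longrightarrow> r b k + p b (Suc k) = q b"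
  shows "(\<Sum>A\<in>Pow B. (\<Prod>c\<in>B - A. r c (k + upto_card A c)) * (\<Prod>a\<in>A. p a (k + upto_card A a)))
    = (\<Prod>b\<in>B. q b)"
  using assms
proof (induction B arbitrary: k rule: finite_linorder_min_induct)
  case empty
  show ?case by simp
next
  case (insert b B)
  have nb: "b \<notin> B" using insert.hyps by auto
  let ?R = "\<lambda>k A. \<Prod>c\<in>B - A. r c (k + upto_card A c)"
  let ?P = "\<lambda>k A. \<Prod>a\<in>A. p a (k + upto_card A a)"
  let ?T = "\<lambda>A. (\<Prod>c\<in>insert b B - A. r c (k + upto_card A c)) * ?P k A"
  have IH: "(\<Sum>A\<in>Pow B. ?R k A * ?P k A) = prod q B" for k
    using insert.IH insert.prems by simp
  \<comment> \<open>No element of \<open>A\<close> lies below the minimum \<open>b\<close>, so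
    leaving out \<open>b\<close> contributes \<open>r b k\<close> and keeps the offset.\<close>
  have without: "?T A = r b k * (?R k A * ?P k A)" if "A \<in> Pow B" for A
  proof -
    have "insert b B - A = insert b (B - A)" using that nb by auto
    moreover have "{a \<in> A. a \<le> b} = {}" using that insert.hyps(2) by force
    then have "upto_card A b = 0" by (simp only: upto_card_def card.empty)
    ultimately show ?thesis using nb insert.hyps(1) by (simp add: mult.assoc)
  qed
  \<comment> \<open>Selecting \<open>b\<close> raises all later counts by one, so the induction
    hypothesis is applied with offset \<open>Suc k\<close>.\<close>
  have added: "?T (insert b A) = p b (Suc k) * (?R (Suc k) A * ?P (Suc k) A)" if "A \<in> Pow B" for A
  proof -
    have fin: "finite A" and nA: "b \<notin> A" using that insert.hyps(1) nb finite_subset by auto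
    have card: "upto_card (insert b A) c = Suc (upto_card A c)" if "c \<in> B" for c
    proof -
      have "{a \<in> insert b A. a \<le> c} = insert b {a \<in> A. a \<le> c}" using that insert.hyps(2) by auto
      then show ?thesis using fin nA by (simp add: upto_card_def)
    qed
    have "{a \<in> insert b A. a \<le> b} = {b}" using that insert.hyps(2) by force
    then have "upto_card (insert b A) b = 1" by (simp add: upto_card_def)
    moreover have "insert b B - insert b A = B - A" using nb by auto
    moreover have "(\<Prod>c\<in>B - A. r c (k + upto_card (insert b A) c)) = ?R (Suc k) A"
      by (intro prod.cong refl) (simp add: card)
    moreover have "(\<Prod>c\<in>A. p c (k + upto_card (insert b A) c)) = ?P (Suc k) A"
      using that by (intro prod.cong refl) (auto simp: card subset_iff)
    ultimately show ?thesis using fin nA by (simp add: mult_ac)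
  qed
  have "(\<Sum>A\<in>Pow (insert b B). ?T A) = (\<Sum>A\<in>Pow B. ?T A) + (\<Sum>A\<in>insert b ` Pow B. ?T A)"
    unfolding Pow_insert by (rule sum.union_disjoint) (use insert.hyps nb in auto)
  also have "(\<Sum>A\<in>insert b ` Pow B. ?T A) = (\<Sum>A\<in>Pow B. ?T (insert b A))"
    by (subst sum.reindex) (use nb in \<open>auto intro!: inj_onI simp: o_def\<close>)
  also have "(\<Sum>A\<in>Pow B. ?T A) = r b k * prod q B"
    by (subst sum.cong[OF refl without]) (simp_all add: sum_distrib_left[symmetric] IH)
  also have "(\<Sum>A\<in>Pow B. ?T (insert b A)) = p b (Suc k) * prod q B"
    using IH[of "Suc k"]
    by (subst sum.cong[OF refl added]) (simp_all add: sum_distrib_left[symmetric])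
  \<comment> \<open>The sum of the two choices at \<open>b\<close> equals \<open>q b\<close>
    whatever \<open>k\<close> is, so the offset disappears.\<close>
  also have "r b k * prod q B + p b (Suc k) * prod q B = prod q (insert b B)"
    using insert.hyps nb insert.prems[of b k] by (simp flip: distrib_right)
  finally show ?case .
qed

section \<open>Standardization of semistandard tableaux\<close>

text \<open>Cells with equal entries lie in distinct columns; they are numbered from left to right.\<close>

definition before :: "(nat \<times> nat \<Rightarrow> nat) \<Rightarrow> nat \<times> nat \<Rightarrow> nat \<times> nat \<Rightarrow> bool" where
  "before T c d \<longleftrightarrow> T c < T d \<or> T c = T d \<and> snd c < snd d"

definition standardization :: "nat list \<Rightarrow> (nat \<times> nat \<Rightarrow> nat) \<Rightarrow> nat \<times> nat \<Rightarrow> nat" where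
  "standardization lam T = restrict (\<lambda>c. Suc (card {d \<in> cells lam. before T d c})) (cells lam)"

definition content_word :: "nat list \<Rightarrow> (nat \<times> nat \<Rightarrow> nat) \<Rightarrow> nat list" where
  "content_word lam T =
     map (\<lambda>k. T (cell_of lam (standardization lam T) (Suc k))) [0..<sum_list lam]"

text \<open>The inverse of the passage from a semistandard tableau to its standardization and
  content word, on pairs with \<open>Des lam S \<subseteq> ascents w\<close>. Entries of
  \<open>S\<close> start at 1 and list indices at 0, hence the shift.\<close>

definition destandardize ::
    "nat list \<Rightarrow> (nat \<times> nat \<Rightarrow> nat) \<Rightarrow> nat list \<Rightarrow> nat \<times> nat \<Rightarrow> nat" where
  "destandardize lam S w = restrict (\<lambda>c. w ! (S c - 1)) (cells lam)"

lemma cells_eq_Sigma: "cells lam = (SIGMA i:{1..length lam}. {1..lam ! (i - 1)})"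
  by (auto simp: cells_def)

lemma finite_cells [simp]: "finite (cells lam)"
  by (simp add: cells_eq_Sigma)

lemma card_cells: "card (cells lam) = sum_list lam"
proof -
  have "card (cells lam) = (\<Sum>i\<in>{1..length lam}. lam ! (i - 1))"
    by (simp add: cells_eq_Sigma)
  also have "\<dots> = (\<Sum>i\<in>{0..<length lam}. lam ! i)"
    by (rule sum.reindex_bij_witness[of _ Suc "\<lambda>i. i - 1"]) auto
  finally show ?thesis by (simp add: sum_list_sum_nth)
qed

lemma cells_down:
  assumes "is_partition lam n" "(i, j) \<in> cells lam" "1 \<le> i'" "i' \<le> i" "1 \<le> j'" "j' \<le> j"
  shows "(i', j') \<in> cells lam"
proof -
  have "lam ! (i - 1) \<le> lam ! (i' - 1)"
  proof (cases "i' = i")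
    case False
    then show ?thesis
      using sorted_wrt_nth_less[of "(\<ge>)" lam "i' - 1" "i - 1"] assms
      by (auto simp: is_partition_def cells_def)
  qed simp
  then show ?thesis using assms by (auto simp: cells_def)
qed

lemma cells_pos: "c \<in> cells lam \<Longrightarrow> 1 \<le> fst c \<and> 1 \<le> snd c"
  by (auto simp: cells_def)

context
  fixes lam :: "nat list" and n :: nat
  assumes part: "is_partition lam n"
begin

lemma sum_list_shape: "sum_list lam = n"
  using part by (simp add: is_partition_def)

section \<open>Standard tableaux: entries, descents and special cells\<close>

context
  fixes S :: "nat \<times> nat \<Rightarrow> nat"
  assumes S: "S \<in> SYT lam"
begin

lemma SYT_bij: "bij_betw S (cells lam) {1..n}"
  using S sum_list_shape by (simp add: SYT_def)

lemma SYT_range: "c \<in> cells lam \<Longrightarrow> S c \<in> {1..n}"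
  using SYT_bij by (auto simp: bij_betw_def)

lemma SYT_eq_iff: "c \<in> cells lam \<Longrightarrow> d \<in> cells lam \<Longrightarrow> S c = S d \<longleftrightarrow> c = d"
  using SYT_bij by (auto simp: bij_betw_def inj_on_def)

lemma cell_of_S: "c \<in> cells lam \<Longrightarrow> cell_of lam S (S c) = c"
  using SYT_bij by (simp add: cell_of_def bij_betw_def)

lemma cell_of_in: "k \<in> {1..n} \<Longrightarrow> cell_of lam S k \<in> cells lam"
  using bij_betw_inv_into[OF SYT_bij] by (auto simp: cell_of_def bij_betw_def)

lemma S_cell_of: "k \<in> {1..n} \<Longrightarrow> S (cell_of lam S k) = k"
  using SYT_bij by (simp add: cell_of_def bij_betw_inv_into_right)

lemma SYT_less:
  assumes "c \<in> cells lam" "d \<in> cells lam" "fst c \<le> fst d" "snd c \<le> snd d" "c \<noteq> d"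
  shows "S c < S d"
proof -
  obtain i j i' j' where c: "c = (i, j)" "d = (i', j')" by (cases c; cases d)
  have row: "(i, j) \<in> cells lam \<and> (i, j') \<in> cells lam \<and> j < j' \<Longrightarrow> S (i, j) < S (i, j')" for i j j'
    using S by (auto simp: SYT_def)
  have col: "(i, j) \<in> cells lam \<and> (i', j) \<in> cells lam \<and> i < i' \<Longrightarrow> S (i, j) < S (i', j)" for i i' j
    using S by (auto simp: SYT_def)
  \<comment> \<open>The corner in the row of \<open>c\<close> and the column of \<open>d\<close>
    links the two cells.\<close>
  have m: "(i, j') \<in> cells lam" using cells_down[OF part, of i' j' i j'] assms c cells_pos
    by fastforce
  have "S (i, j) \<le> S (i, j')" using row[of i j j'] m assms c by (cases "j = j'") auto
  moreover have "S (i, j') \<le> S (i', j')" using col[of i j' i'] m assms c by (cases "i = i'") auto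
  ultimately have "S c \<le> S d" using c by simp
  then show ?thesis using SYT_eq_iff[OF assms(1,2)] assms(5) by simp
qed

text \<open>All entries smaller than an entry of the first column lie in higher rows.\<close>

lemma Des_if_not_spec:
  assumes j: "j \<in> {1..<n}" and "cell_of lam S (j + 1) \<notin> spec lam"
  shows "j \<in> Des lam S"
proof -
  let ?c = "cell_of lam S j" and ?d = "cell_of lam S (j + 1)"
  have c: "?c \<in> cells lam" "?d \<in> cells lam" "S ?c = j" "S ?d = j + 1"
    using j cell_of_in S_cell_of by auto
  then have "snd ?d = 1" using assms(2) by (simp add: spec_def)
  then have "fst ?c < fst ?d"
    using SYT_less[OF c(2) c(1)] c cells_pos[OF c(1)]
    by (metis leI not_less_eq_eq order.strict_implies_order Suc_eq_plus1 less_add_one order_less_asym n_not_Suc_n)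
  then show ?thesis using j by (simp add: Des_def sum_list_shape)
qed

text \<open>Adding the single cell \<open>c\<close> can create an ascent only at
  \<open>S c - 1\<close>, and it is new exactly if this position was not a descent. The bound
  \<open>2 \<le> S c\<close> keeps the natural subtraction meaningful.\<close>

lemma espec_iff:
  assumes c: "c \<in> spec lam"
  shows "c \<in> espec lam S \<longleftrightarrow> 2 \<le> S c \<and> S c - 1 \<notin> Des lam S \<and> snd c = snd (cell_of lam S (S c - 1)) + 1"
proof -
  have cc: "c \<in> cells lam" using c by (simp add: spec_def)
  have S1: "1 \<le> S c" "S c \<le> n" using SYT_range[OF cc] by auto
  have "Asc lam S {} = Des lam S" by (simp add: Asc_def Des_def)
  moreover have "Asc lam S {c} = Des lam S \<union>
      {k \<in> {1..<n}. k + 1 = S c \<and> snd c = snd (cell_of lam S k) + 1}"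
  proof -
    have "cell_of lam S (k + 1) = c \<longleftrightarrow> k + 1 = S c" if "k \<in> {1..<n}" for k
      using cell_of_S[OF cc] S_cell_of[of "k + 1"] that by auto
    then show ?thesis unfolding Asc_def Des_def sum_list_shape by auto
  qed
  ultimately have "c \<in> espec lam S \<longleftrightarrow>
      \<not> {k \<in> {1..<n}. k + 1 = S c \<and> snd c = snd (cell_of lam S k) + 1} \<subseteq> Des lam S"
    using c unfolding espec_def by auto
  also have "\<dots> \<longleftrightarrow> (\<exists>k\<in>{1..<n}. k + 1 = S c \<and> snd c = snd (cell_of lam S k) + 1 \<and> k \<notin> Des lam S)"
    by auto
  also have "\<dots> \<longleftrightarrow> 2 \<le> S c \<and> S c - 1 \<notin> Des lam S \<and> snd c = snd (cell_of lam S (S c - 1)) + 1"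
  proof
    assume r: "2 \<le> S c \<and> S c - 1 \<notin> Des lam S \<and> snd c = snd (cell_of lam S (S c - 1)) + 1"
    then show "\<exists>k\<in>{1..<n}. k + 1 = S c \<and> snd c = snd (cell_of lam S k) + 1 \<and> k \<notin> Des lam S"
      using S1 by (intro bexI[of _ "S c - 1"]) auto
  next
    assume "\<exists>k\<in>{1..<n}. k + 1 = S c \<and> snd c = snd (cell_of lam S k) + 1 \<and> k \<notin> Des lam S"
    then obtain k where k: "k \<in> {1..<n}" "k + 1 = S c" "snd c = snd (cell_of lam S k) + 1" "k \<notin> Des lam S"
      by blast
    then have "S c - 1 = k" by simp
    with k show "2 \<le> S c \<and> S c - 1 \<notin> Des lam S \<and> snd c = snd (cell_of lam S (S c - 1)) + 1" by simp
  qed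
  finally show ?thesis .
qed

text \<open>The left neighbour of a special cell has a smaller entry. Hence every special cell is
  \<open>cell_of lam S (j + 1)\<close> for some \<open>j \<ge> 1\<close>.\<close>

lemma spec_S_ge_2:
  assumes c: "c \<in> spec lam"
  shows "2 \<le> S c"
proof -
  let ?d = "(fst c, snd c - 1)"
  have c2: "c \<in> cells lam" "snd c \<noteq> 1" using c by (auto simp: spec_def)
  have p: "1 \<le> fst c" "2 \<le> snd c" using cells_pos[OF c2(1)] c2(2) by auto
  have d: "?d \<in> cells lam"
    using cells_down[OF part, of "fst c" "snd c" "fst c" "snd c - 1"] c2 p by simp
  have "S ?d < S c" by (rule SYT_less[OF d c2(1)]) (use p in \<open>auto simp: prod_eq_iff\<close>)
  then show ?thesis using SYT_range[OF d] by simp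
qed

text \<open>Tableau weights are products over cells, whereas the claimed formula has products over
  \<open>j\<close>; sending \<open>c\<close> to \<open>S c - 1\<close> translates between them. The
  predicate \<open>P\<close> makes room for a condition on ascents.\<close>

lemma prod_spec_reindex:
  assumes "X \<subseteq> spec lam"
  shows "(\<Prod>c\<in>{c \<in> X. P (S c - 1)}. f c) =
    (\<Prod>j\<in>{j \<in> {1..<n}. cell_of lam S (j + 1) \<in> X \<and> P j}. f (cell_of lam S (j + 1)))"
proof (rule prod.reindex_bij_witness[of _ "\<lambda>j. cell_of lam S (j + 1)" "\<lambda>c. S c - 1"])
  fix c assume c: "c \<in> {c \<in> X. P (S c - 1)}"
  then have cs: "c \<in> spec lam" "c \<in> cells lam" using assms by (auto simp: spec_def)
  have eq: "S c - 1 + 1 = S c" using spec_S_ge_2[OF cs(1)] by simp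
  show 1: "cell_of lam S (S c - 1 + 1) = c" unfolding eq by (rule cell_of_S[OF cs(2)])
  show "S c - 1 \<in> {j \<in> {1..<n}. cell_of lam S (j + 1) \<in> X \<and> P j}"
    using c 1 spec_S_ge_2[OF cs(1)] SYT_range[OF cs(2)] by auto
  show "f (cell_of lam S (S c - 1 + 1)) = f c" using 1 by simp
qed (use S_cell_of in auto)

end

section \<open>From a standard tableau and a word to a semistandard tableau\<close>

context
  fixes S :: "nat \<times> nat \<Rightarrow> nat" and w :: "nat list" and N :: nat
  assumes S: "S \<in> SYT lam" and w: "w \<in> words N n" and desc: "Des lam S \<subseteq> ascents w"
begin

lemma word_mono: "k \<le> l \<Longrightarrow> 1 \<le> k \<Longrightarrow> l \<le> n \<Longrightarrow> w ! (k - 1) \<le> w ! (l - 1)"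
  using w by (auto simp: words_def intro!: sorted_nth_mono)

lemma destandardize_apply: "c \<in> cells lam \<Longrightarrow> destandardize lam S w c = w ! (S c - 1)"
  by (simp add: destandardize_def)

text \<open>Along a constant stretch of \<open>w\<close> there are no descents, so the rows weakly decrease.\<close>

lemma destandardize_eq_rows:
  assumes c: "c \<in> cells lam" and d: "d \<in> cells lam" and less: "S c \<le> S d"
    and eq: "destandardize lam S w c = destandardize lam S w d"
  shows "fst d \<le> fst c"
proof -
  have range: "1 \<le> S c" "S d \<le> n" using SYT_range[OF S c] SYT_range[OF S d] by auto
  have const: "w ! (S c - 1) = w ! (S d - 1)" using eq c d by (simp add: destandardize_apply)
  have "fst (cell_of lam S k) \<le> fst c" if "S c \<le> k" "k \<le> S d" for k
    using that
  proof (induction k rule: dec_induct)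
    case base
    show ?case using cell_of_S[OF S c] by simp
  next
    case (step k)
    have "w ! (S c - 1) \<le> w ! (k - 1)" "w ! (k - 1) \<le> w ! k" "w ! k \<le> w ! (S d - 1)"
      using word_mono[of "S c" k] word_mono[of k "Suc k"] word_mono[of "Suc k" "S d"] step range
      by auto
    then have "k \<notin> ascents w" using const by (simp add: ascents_def)
    then have "k \<notin> Des lam S" using desc by blast
    then show ?case using step range by (auto simp: Des_def sum_list_shape)
  qed
  from this[of "S d"] show ?thesis using less cell_of_S[OF S d] by simp
qed

text \<open>By \<open>destandardize_eq_rows\<close> the later cell is weakly above; were it also
  weakly to the left, its entry in \<open>S\<close> could not be larger.\<close>

lemma destandardize_eq_cols:
  assumes c: "c \<in> cells lam" and d: "d \<in> cells lam" and less: "S c < S d"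
    and eq: "destandardize lam S w c = destandardize lam S w d"
  shows "snd c < snd d"
proof (rule ccontr)
  assume "\<not> snd c < snd d"
  then have "S d \<le> S c"
    using SYT_less[OF S d c] destandardize_eq_rows[OF c d _ eq] less by (cases "c = d") auto
  then show False using less by simp
qed

text \<open>Monotonicity of \<open>w\<close> settles unequal values, and
  \<open>destandardize_eq_cols\<close> settles ties. The converse holds because distinct cells have
  distinct entries and \<open>before\<close> is asymmetric. Thus \<open>S\<close> can be recovered
  from the destandardized tableau.\<close>

lemma S_less_iff_before:
  assumes c: "c \<in> cells lam" and d: "d \<in> cells lam"
  shows "S c < S d \<longleftrightarrow> before (destandardize lam S w) c d"
proof -
  have imp: "before (destandardize lam S w) c d" if c: "c \<in> cells lam" and d: "d \<in> cells lam" and less: "S c < S d" for c d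
  proof -
    have "destandardize lam S w c \<le> destandardize lam S w d"
      using word_mono[of "S c" "S d"] less SYT_range[OF S c] SYT_range[OF S d] c d
      by (simp add: destandardize_apply)
    then show ?thesis using destandardize_eq_cols[OF c d less] by (auto simp: before_def)
  qed
  have "\<not> before (destandardize lam S w) c d" if "\<not> S c < S d"
  proof (cases "c = d")
    case True then show ?thesis by (simp add: before_def)
  next
    case False
    then have "S d < S c" using that SYT_eq_iff[OF S c d] by simp
    from imp[OF d c this] show ?thesis by (auto simp: before_def)
  qed
  then show ?thesis using imp[OF c d] by blast
qed

lemma destandardize_SSYT: "destandardize lam S w \<in> SSYT lam N"
proof -
  have "destandardize lam S w c \<in> {1..N}" if "c \<in> cells lam" for c
  proof -
    have "S c - 1 < length w" using SYT_range[OF S that] w by (auto simp: words_def)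
    then have "w ! (S c - 1) \<in> set w" by simp
    then show ?thesis using w that by (auto simp: words_def destandardize_apply)
  qed
  moreover have "destandardize lam S w (i, j) \<le> destandardize lam S w (i, j')"
    if "(i, j) \<in> cells lam \<and> (i, j') \<in> cells lam \<and> j < j'" for i j j'
    using S_less_iff_before[of "(i, j)" "(i, j')"] SYT_less[OF S, of "(i, j)" "(i, j')"] that
    by (auto simp: before_def)
  moreover have "destandardize lam S w (i, j) < destandardize lam S w (i', j)"
    if "(i, j) \<in> cells lam \<and> (i', j) \<in> cells lam \<and> i < i'" for i i' j
    using S_less_iff_before[of "(i, j)" "(i', j)"] SYT_less[OF S, of "(i, j)" "(i', j)"] that
    by (auto simp: before_def)
  ultimately show ?thesis unfolding SSYT_def by (auto simp: destandardize_def)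
qed

text \<open>The cells \<open>before\<close> a cell \<open>c\<close> are those with smaller entry in
  \<open>S\<close>, and there are \<open>S c - 1\<close> of them.\<close>

lemma standardization_destandardize: "standardization lam (destandardize lam S w) = S"
proof
  fix c
  show "standardization lam (destandardize lam S w) c = S c"
  proof (cases "c \<in> cells lam")
    case True
    have "card {d \<in> cells lam. before (destandardize lam S w) d c} = card {d \<in> cells lam. S d < S c}"
      by (intro arg_cong[where f = card] Collect_cong conj_cong refl) (simp add: S_less_iff_before True)
    also have "\<dots> = card (S ` {d \<in> cells lam. S d < S c})"
      using SYT_eq_iff[OF S] by (intro card_image[symmetric]) (auto simp: inj_on_def)
    also have "S ` {d \<in> cells lam. S d < S c} = {1..<S c}"
    proof -
      have "k \<in> S ` {d \<in> cells lam. S d < S c}" if "k \<in> {1..<S c}" for k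
        using S_cell_of[OF S, of k] cell_of_in[OF S, of k] that SYT_range[OF S True]
        by (intro image_eqI[of _ _ "cell_of lam S k"]) auto
      then show ?thesis using SYT_range[OF S] by fastforce
    qed
    finally show ?thesis using True SYT_range[OF S True] by (simp add: standardization_def)
  next
    case False
    \<comment> \<open>Outside the shape both sides are \<open>undefined\<close>.\<close>
    have "S \<in> cells lam \<rightarrow>\<^sub>E {1..sum_list lam}" using S by (simp add: SYT_def)
    from PiE_arb[OF this False] show ?thesis using False by (simp add: standardization_def)
  qed
qed

lemma content_word_destandardize: "content_word lam (destandardize lam S w) = w"
  using w cell_of_in[OF S] S_cell_of[OF S]
  by (auto simp: content_word_def sum_list_shape standardization_destandardize words_def destandardize_apply intro!: nth_equalityI)

text \<open>Along a constant stretch of \<open>w\<close> the columns strictly increase. An equal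
  entry in the adjacent left column must therefore sit in the cell of \<open>S c - 1\<close>, and
  equality of the values excludes an ascent, hence a descent, at that position. This identifies the
  special cells that lose their factor in the weight.\<close>

lemma equal_left_iff_espec:
  assumes c: "c \<in> spec lam"
  shows "(\<exists>u. (u, snd c - 1) \<in> cells lam \<and> destandardize lam S w (u, snd c - 1) = destandardize lam S w c) \<longleftrightarrow>
    c \<in> espec lam S \<and> S c - 1 \<notin> ascents w"
proof -
  have cc: "c \<in> cells lam" "snd c \<noteq> 1" using c by (auto simp: spec_def)
  have S2: "2 \<le> S c" using spec_S_ge_2[OF S c] .
  have Sn: "S c \<le> n" using SYT_range[OF S cc(1)] by simp
  have sc: "1 \<le> snd c" using cells_pos[OF cc(1)] by simp
  let ?d = "cell_of lam S (S c - 1)"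
  have d: "?d \<in> cells lam" "S ?d = S c - 1"
  proof -
    have "S c - 1 \<in> {1..n}" using S2 Sn by auto
    then show "?d \<in> cells lam" "S ?d = S c - 1" using cell_of_in[OF S] S_cell_of[OF S] by auto
  qed
  have asc: "S c - 1 \<notin> ascents w \<longleftrightarrow> destandardize lam S w ?d = destandardize lam S w c"
  proof -
    have "w ! (S c - 1 - 1) \<le> w ! (S c - 1)" using word_mono[of "S c - 1" "S c"] S2 Sn by auto
    moreover have "length w = n" using w by (simp add: words_def)
    ultimately show ?thesis using S2 Sn d cc by (auto simp: ascents_def destandardize_apply)
  qed
  show ?thesis
  proof
    assume "\<exists>u. (u, snd c - 1) \<in> cells lam \<and> destandardize lam S w (u, snd c - 1) = destandardize lam S w c"
    then obtain u where u: "(u, snd c - 1) \<in> cells lam" "destandardize lam S w (u, snd c - 1) = destandardize lam S w c"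
      by blast
    let ?e = "(u, snd c - 1)"
    have e: "S ?e < S c" unfolding S_less_iff_before[OF u(1) cc(1)] using u(2) sc
      by (simp add: before_def)
    \<comment> \<open>A third cell between them would need a column strictly between two adjacent
      ones.\<close>
    have "?d = ?e"
    proof (rule ccontr)
      assume ne: "?d \<noteq> ?e"
      then have less: "S ?e < S ?d" "S ?d < S c"
        using e d SYT_eq_iff[OF S d(1) u(1)] S2 by auto
      then have "destandardize lam S w ?e = destandardize lam S w ?d" "destandardize lam S w ?d = destandardize lam S w c"
        using S_less_iff_before[OF u(1) d(1)] S_less_iff_before[OF d(1) cc(1)] u(2)
        by (auto simp: before_def)
      then have "snd ?e < snd ?d" "snd ?d < snd c"
        using destandardize_eq_cols[OF u(1) d(1) less(1)] destandardize_eq_cols[OF d(1) cc(1) less(2)]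
        by auto
      then show False by simp
    qed
    then have "S c - 1 \<notin> ascents w" "snd c = snd ?d + 1" using asc u(2) sc by auto
    then show "c \<in> espec lam S \<and> S c - 1 \<notin> ascents w"
      using espec_iff[OF S c] S2 desc by auto
  next
    assume a: "c \<in> espec lam S \<and> S c - 1 \<notin> ascents w"
    then have "snd c = snd ?d + 1" using espec_iff[OF S c] by simp
    then have "(fst ?d, snd c - 1) = ?d" by simp
    then show "\<exists>u. (u, snd c - 1) \<in> cells lam \<and> destandardize lam S w (u, snd c - 1) = destandardize lam S w c"
      using asc a d by metis
  qed
qed

text \<open>Without ties in the column to the left, \<open>before\<close> reduces to comparing
  values.\<close>

lemma wt_destandardize:
  assumes c: "c \<in> cells lam"
    and ne: "\<forall>u. (u, snd c - 1) \<in> cells lam \<longrightarrow> destandardize lam S w (u, snd c - 1) \<noteq> destandardize lam S w c"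
  shows "wt lam (destandardize lam S w) c = wt lam S c"
proof -
  have "destandardize lam S w (u, v) < destandardize lam S w c \<longleftrightarrow> S (u, v) < S c"
    if "(u, v) \<in> cells lam" "v = snd c - 1" for u v
    using S_less_iff_before[OF that(1) c] ne that by (auto simp: before_def)
  then have "{(u, v) \<in> cells lam. v = snd c - 1 \<and> fst c \<le> u \<and> destandardize lam S w (u, v) < destandardize lam S w c} =
      {(u, v) \<in> cells lam. v = snd c - 1 \<and> fst c \<le> u \<and> S (u, v) < S c}" by auto
  then show ?thesis by (cases c) (simp add: wt_def)
qed

lemma prod_xvar_destandardize: "(\<Prod>c\<in>cells lam. xvar (destandardize lam S w c)) = word_monom w"
proof -
  have "(\<Prod>c\<in>cells lam. xvar (destandardize lam S w c)) = (\<Prod>c\<in>cells lam. xvar (w ! (S c - 1)))"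
    by (intro prod.cong refl) (simp add: destandardize_apply)
  also have "\<dots> = (\<Prod>k\<in>{1..n}. xvar (w ! (k - 1)))"
    by (rule prod.reindex_bij_betw[OF SYT_bij[OF S]])
  also have "\<dots> = (\<Prod>k\<in>{0..<n}. xvar (w ! k))"
    by (rule prod.reindex_bij_witness[of _ Suc "\<lambda>i. i - 1"]) auto
  also have "\<dots> = word_monom w"
    using w by (simp add: word_monom_def words_def prod.list_conv_set_nth)
  finally show ?thesis .
qed

end

section \<open>From a semistandard tableau to a standard tableau and a word\<close>

context
  fixes T :: "nat \<times> nat \<Rightarrow> nat" and N :: nat
  assumes T: "T \<in> SSYT lam N"
begin

lemma SSYT_row:
  "(i, j) \<in> cells lam \<Longrightarrow> (i, j') \<in> cells lam \<Longrightarrow> j \<le> j' \<Longrightarrow> T (i, j) \<le> T (i, j')"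
  using T by (cases "j = j'") (auto simp: SSYT_def)

lemma SSYT_col:
  "(i, j) \<in> cells lam \<Longrightarrow> (i', j) \<in> cells lam \<Longrightarrow> i < i' \<Longrightarrow> T (i, j) < T (i', j)"
  using T by (auto simp: SSYT_def)

text \<open>Columns are strict, so a tie can only occur between cells in different columns.\<close>

lemma before_total:
  assumes "c \<in> cells lam" "d \<in> cells lam" "c \<noteq> d"
  shows "before T c d \<or> before T d c"
proof (cases "snd c = snd d")
  case True
  then have "fst c < fst d \<or> fst d < fst c" using assms(3) by (auto simp: prod_eq_iff)
  moreover have "(fst d, snd c) = d" using True by simp
  ultimately show ?thesis
    using SSYT_col[of "fst c" "snd c" "fst d"] SSYT_col[of "fst d" "snd c" "fst c"] assms(1,2)
    by (auto simp: before_def)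
qed (auto simp: before_def)

lemma before_if_smaller:
  assumes "c \<in> cells lam" "d \<in> cells lam" "fst c \<le> fst d" "snd c \<le> snd d" "c \<noteq> d"
  shows "before T c d"
proof -
  obtain i j i' j' where c: "c = (i, j)" "d = (i', j')" by (cases c; cases d)
  have m: "(i, j') \<in> cells lam" using cells_down[OF part, of i' j' i j'] assms c cells_pos
    by fastforce
  have "T (i, j) \<le> T (i, j')" using SSYT_row m assms c by simp
  moreover have "T (i, j') < T (i', j')" if "i \<noteq> i'" using SSYT_col m assms c that by simp
  ultimately show ?thesis using assms c by (cases "i = i'") (auto simp: before_def)
qed

abbreviation (input) "S\<^sub>T \<equiv> standardization lam T"

lemma standardization_less:
  assumes "c \<in> cells lam" "d \<in> cells lam" "before T c d"
  shows "S\<^sub>T c < S\<^sub>T d"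
proof -
  have "{e \<in> cells lam. before T e c} \<subset> {e \<in> cells lam. before T e d}"
  proof
    show "{e \<in> cells lam. before T e c} \<subseteq> {e \<in> cells lam. before T e d}"
      using assms(3) by (auto simp: before_def)
    have "c \<in> {e \<in> cells lam. before T e d}" "c \<notin> {e \<in> cells lam. before T e c}"
      using assms by (auto simp: before_def)
    then show "{e \<in> cells lam. before T e c} \<noteq> {e \<in> cells lam. before T e d}" by blast
  qed
  then have "card {e \<in> cells lam. before T e c} < card {e \<in> cells lam. before T e d}"
    by (intro psubset_card_mono) simp_all
  then show ?thesis using assms by (simp add: standardization_def)
qed

lemma standardization_less_imp_before:
  assumes "c \<in> cells lam" "d \<in> cells lam" "S\<^sub>T c < S\<^sub>T d"
  shows "before T c d"
  using standardization_less[OF assms(2,1)] before_total[OF assms(1,2)] assms(3)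
  by (cases "c = d") auto

lemma standardization_bij: "bij_betw S\<^sub>T (cells lam) {1..n}"
proof -
  have inj: "inj_on S\<^sub>T (cells lam)"
  proof (rule inj_onI, rule ccontr)
    fix c d assume "c \<in> cells lam" "d \<in> cells lam" "S\<^sub>T c = S\<^sub>T d" "c \<noteq> d"
    then show False
      using standardization_less[of c d] standardization_less[of d c] before_total[of c d] by auto
  qed
  have "S\<^sub>T c \<in> {1..n}" if c: "c \<in> cells lam" for c
  proof -
    have "{d \<in> cells lam. before T d c} \<subset> cells lam" using c by (auto simp: before_def)
    then have "card {d \<in> cells lam. before T d c} < n"
      using psubset_card_mono[OF finite_cells] card_cells sum_list_shape by metis
    then show ?thesis using c by (simp add: standardization_def)
  qed
  then have "S\<^sub>T ` cells lam = {1..n}"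
    using card_image[OF inj] card_cells[of lam] sum_list_shape by (intro card_subset_eq) auto
  then show ?thesis using inj by (simp add: bij_betw_def)
qed

lemma standardization_SYT: "S\<^sub>T \<in> SYT lam"
proof -
  have "S\<^sub>T \<in> cells lam \<rightarrow>\<^sub>E {1..n}"
    using standardization_bij by (auto simp: bij_betw_def standardization_def)
  moreover have "S\<^sub>T c < S\<^sub>T d"
    if "c \<in> cells lam" "d \<in> cells lam" "fst c \<le> fst d" "snd c \<le> snd d" "c \<noteq> d" for c d
    using standardization_less[OF that(1,2)] before_if_smaller[OF that] .
  ultimately show ?thesis
    unfolding SYT_def sum_list_shape using standardization_bij by auto
qed

lemma content_word_nth:
  assumes "c \<in> cells lam"
  shows "content_word lam T ! (S\<^sub>T c - 1) = T c"
proof -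
  have "S\<^sub>T c \<in> {1..n}" by (rule SYT_range[OF standardization_SYT assms])
  then show ?thesis
    using cell_of_S[OF standardization_SYT assms] by (auto simp: content_word_def sum_list_shape)
qed

lemma content_word_words: "content_word lam T \<in> words N n"
proof -
  let ?w = "content_word lam T" and ?c = "\<lambda>k. cell_of lam S\<^sub>T (Suc k)"
  have c: "?c k \<in> cells lam" "S\<^sub>T (?c k) = Suc k" if "k < n" for k
    using cell_of_in[OF standardization_SYT, of "Suc k"] S_cell_of[OF standardization_SYT, of "Suc k"] that
    by auto
  have "T (?c k) \<le> T (?c l)" if "k < l" "l < n" for k l
    using standardization_less_imp_before[of "?c k" "?c l"] c[of k] c[of l] that
    by (auto simp: before_def)
  then have "sorted ?w"
    by (auto simp: content_word_def sum_list_shape sorted_wrt_iff_nth_less)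
  moreover have "T (?c k) \<in> {1..N}" if "k < n" for k
    using T c[OF that] by (auto simp: SSYT_def)
  then have "set ?w \<subseteq> {1..N}" by (auto simp: content_word_def sum_list_shape)
  ultimately show ?thesis by (simp add: words_def content_word_def sum_list_shape)
qed

lemma Des_standardization: "Des lam S\<^sub>T \<subseteq> ascents (content_word lam T)"
proof
  fix k assume k: "k \<in> Des lam S\<^sub>T"
  let ?c = "cell_of lam S\<^sub>T k" and ?d = "cell_of lam S\<^sub>T (k + 1)"
  have kn: "k \<in> {1..<n}" and row: "fst ?c < fst ?d" using k by (auto simp: Des_def sum_list_shape)
  have c: "?c \<in> cells lam" "?d \<in> cells lam" "S\<^sub>T ?c = k" "S\<^sub>T ?d = k + 1"
    using cell_of_in[OF standardization_SYT] S_cell_of[OF standardization_SYT] kn by auto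
  have b: "before T ?c ?d" using standardization_less_imp_before[OF c(1,2)] c by simp
  have "T ?c < T ?d"
  proof (rule ccontr)
    assume not: "\<not> T ?c < T ?d"
    then have col: "snd ?c < snd ?d" using b by (auto simp: before_def)
    \<comment> \<open>Here the values agree and tie breaking puts \<open>?d\<close> strictly to the
      right of \<open>?c\<close>. The corner below \<open>?c\<close> in the row of \<open>?d\<close>
      then has a value larger than \<open>T ?c\<close> and at most \<open>T ?d\<close>, a
      contradiction.\<close>
    have m: "(fst ?d, snd ?c) \<in> cells lam"
      using cells_down[OF part, of "fst ?d" "snd ?d" "fst ?d" "snd ?c"] c cells_pos[OF c(1)] cells_pos[OF c(2)] col
      by simp
    have "T ?c < T (fst ?d, snd ?c)" using SSYT_col[of "fst ?c" "snd ?c" "fst ?d"] m c row by simp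
    also have "\<dots> \<le> T ?d" using SSYT_row[OF m, of "snd ?d"] c col by simp
    finally show False using not by simp
  qed
  then show "k \<in> ascents (content_word lam T)"
    using content_word_nth[OF c(1)] content_word_nth[OF c(2)] c kn content_word_words
    by (simp add: ascents_def words_def)
qed

lemma destandardize_standardization: "destandardize lam S\<^sub>T (content_word lam T) = T"
proof
  fix c
  have T': "T \<in> cells lam \<rightarrow>\<^sub>E {1..N}" using T by (simp add: SSYT_def)
  show "destandardize lam S\<^sub>T (content_word lam T) c = T c"
  proof (cases "c \<in> cells lam")
    case True
    then show ?thesis using content_word_nth[OF True] by (simp add: destandardize_def)
  next
    case False
    from PiE_arb[OF T' False] show ?thesis using False by (simp add: destandardize_def)
  qed
qed

end

end

section \<open>Expansions in words\<close>

text \<open>The Hall-Littlewood weight of the tableau built from \<open>S\<close> and a word with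
  ascent set \<open>B\<close>; the word matters only through \<open>B\<close>.\<close>

definition P_coeff :: "nat list \<Rightarrow> (nat \<times> nat \<Rightarrow> nat) \<Rightarrow> nat set \<Rightarrow> int poly" where
  "P_coeff lam S B =
     (\<Prod>j\<in>{j \<in> {1..<sum_list lam}. cell_of lam S (j + 1) \<in> spec lam - espec lam S}.
        1 - tvar ^ wt lam S (cell_of lam S (j + 1))) *
     (\<Prod>j\<in>{j \<in> B. cell_of lam S (j + 1) \<in> espec lam S}.
        1 - tvar ^ wt lam S (cell_of lam S (j + 1)))"

text \<open>The summand of \<open>S\<close> in the claimed coefficient as a function of
  \<open>A = sub beta\<close>; the conditional exponent is \<open>mj'\<close>.\<close>

definition expansion_coeff :: "nat list \<Rightarrow> (nat \<times> nat \<Rightarrow> nat) \<Rightarrow> nat set \<Rightarrow> int poly" where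
  "expansion_coeff lam S A =
     (\<Prod>j\<in>{j \<in> A. cell_of lam S (j + 1) \<in> espec lam S}.
        tvar ^ upto_card A j - tvar ^ wt lam S (cell_of lam S (j + 1))) *
     (\<Prod>j\<in>{j \<in> {1..<sum_list lam}. cell_of lam S (j + 1) \<in> spec lam - espec lam S}.
        tvar ^ (if j \<in> A - Des lam S then upto_card A j else 0) *
        (1 - tvar ^ wt lam S (cell_of lam S (j + 1))))"

lemma finite_SYT [simp]: "finite (SYT lam)"
  by (rule finite_subset[of _ "cells lam \<rightarrow>\<^sub>E {1..sum_list lam}"]) (auto simp: SYT_def intro: finite_PiE)

lemma destandardize_weight:
  assumes part: "is_partition lam n" and S: "S \<in> SYT lam" and w: "w \<in> words N n"
    and desc: "Des lam S \<subseteq> ascents w"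
  defines "T \<equiv> destandardize lam S w"
  shows "(\<Prod>c\<in>{(i, j) \<in> cells lam. 1 < j \<and> (\<forall>u. (u, j - 1) \<in> cells lam \<longrightarrow> T (u, j - 1) \<noteq> T (i, j))}.
      1 - tvar ^ wt lam T c) = P_coeff lam S (ascents w)"
proof -
  let ?f = "\<lambda>c. 1 - tvar ^ wt lam S c"
  let ?X = "spec lam - espec lam S" and ?Y = "{c \<in> espec lam S. S c - 1 \<in> ascents w}"
  have sum: "sum_list lam = n" using part by (simp add: is_partition_def)
  have "1 < snd c \<longleftrightarrow> snd c \<noteq> 1" if "c \<in> cells lam" for c
    using cells_pos[OF that] by auto
  then have "{(i, j) \<in> cells lam. 1 < j \<and> (\<forall>u. (u, j - 1) \<in> cells lam \<longrightarrow> T (u, j - 1) \<noteq> T (i, j))} =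
      {c \<in> spec lam. \<not> (\<exists>u. (u, snd c - 1) \<in> cells lam \<and> T (u, snd c - 1) = T c)}"
    unfolding spec_def by fastforce
  \<comment> \<open>A special cell \<open>c\<close> loses its factor exactly when it is in
    \<open>espec lam S\<close> and \<open>w\<close> does not ascend at
    \<open>S c - 1\<close>.\<close>
  also have set: "\<dots> = ?X \<union> ?Y"
    using equal_left_iff_espec[OF part S w desc] unfolding T_def espec_def[of lam S] by blast
  finally have "(\<Prod>c\<in>{(i, j) \<in> cells lam. 1 < j \<and> (\<forall>u. (u, j - 1) \<in> cells lam \<longrightarrow> T (u, j - 1) \<noteq> T (i, j))}.
      1 - tvar ^ wt lam T c) = (\<Prod>c\<in>?X \<union> ?Y. 1 - tvar ^ wt lam T c)" by simp
  also have "\<dots> = (\<Prod>c\<in>?X \<union> ?Y. ?f c)"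
  proof (intro prod.cong refl)
    fix c assume "c \<in> ?X \<union> ?Y"
    then have "c \<in> cells lam" "\<forall>u. (u, snd c - 1) \<in> cells lam \<longrightarrow> T (u, snd c - 1) \<noteq> T c"
      unfolding set[symmetric] by (auto simp: spec_def)
    then show "1 - tvar ^ wt lam T c = ?f c"
      using wt_destandardize[OF part S w desc] unfolding T_def by simp
  qed
  also have "\<dots> = (\<Prod>c\<in>?X. ?f c) * (\<Prod>c\<in>?Y. ?f c)"
    by (rule prod.union_disjoint) (auto intro: finite_subset[of _ "cells lam"] simp: spec_def espec_def)
  also have "(\<Prod>c\<in>?X. ?f c) =
      (\<Prod>j\<in>{j \<in> {1..<n}. cell_of lam S (j + 1) \<in> ?X}. ?f (cell_of lam S (j + 1)))"
    using prod_spec_reindex[OF part S Diff_subset, where P = "\<lambda>_. True" and f = ?f]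
    by (simp only: simp_thms Collect_mem_eq)
  also have "(\<Prod>c\<in>?Y. ?f c) =
      (\<Prod>j\<in>{j \<in> {1..<n}. cell_of lam S (j + 1) \<in> espec lam S \<and> j \<in> ascents w}. ?f (cell_of lam S (j + 1)))"
    by (rule prod_spec_reindex[OF part S]) (auto simp: espec_def)
  also have "{j \<in> {1..<n}. cell_of lam S (j + 1) \<in> espec lam S \<and> j \<in> ascents w} =
      {j \<in> ascents w. cell_of lam S (j + 1) \<in> espec lam S}"
    using ascents_subset[OF w] by auto
  finally show ?thesis unfolding P_coeff_def sum .
qed

text \<open>Standardization matches semistandard tableaux with pairs of a word and a standard
  tableau whose descents are ascents of the word; grouping by words gives the coefficients.\<close>

lemma hall_littlewood_P_words:
  assumes part: "is_partition lam n"
  shows "hall_littlewood_P N lam = (\<Sum>w\<in>words N n.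
    mscale (\<Sum>S | S \<in> SYT lam \<and> Des lam S \<subseteq> ascents w. P_coeff lam S (ascents w)) (word_monom w))"
proof -
  let ?D = "SIGMA w:words N n. {S \<in> SYT lam. Des lam S \<subseteq> ascents w}"
  have "hall_littlewood_P N lam = (\<Sum>(w, S)\<in>?D. mscale (P_coeff lam S (ascents w)) (word_monom w))"
    unfolding hall_littlewood_P_def
  proof (rule sum.reindex_bij_witness[of _ "\<lambda>(w, S). destandardize lam S w"
        "\<lambda>T. (content_word lam T, standardization lam T)"], goal_cases)
    case (1 T)
    then show ?case using destandardize_standardization[OF part] by simp
  next
    case (2 T)
    then show ?case
      using content_word_words[OF part] standardization_SYT[OF part] Des_standardization[OF part]
      by simp
  next
    case (3 p)
    then show ?case
      using content_word_destandardize[OF part] standardization_destandardize[OF part]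
      by (auto split: prod.split)
  next
    case (4 p)
    then show ?case using destandardize_SSYT[OF part] by auto
  next
    case (5 T)
    let ?w = "content_word lam T" and ?S = "standardization lam T"
    have *: "?S \<in> SYT lam" "?w \<in> words N n" "Des lam ?S \<subseteq> ascents ?w"
      using 5 standardization_SYT[OF part] content_word_words[OF part] Des_standardization[OF part]
      by auto
    show ?case
      using destandardize_weight[OF part *] prod_xvar_destandardize[OF part *]
        destandardize_standardization[OF part 5] by simp
  qed
  also have "\<dots> = (\<Sum>w\<in>words N n. \<Sum>S | S \<in> SYT lam \<and> Des lam S \<subseteq> ascents w.
      mscale (P_coeff lam S (ascents w)) (word_monom w))"
    by (rule sum.Sigma[symmetric]) auto
  finally show ?thesis by (simp add: mpoly_t.scale_sum_left)
qed

text \<open>An instance of \<open>sum_subsets_telescope\<close>: \<open>r\<close> collects the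
  factors of elements of \<open>B\<close> left out of \<open>A\<close>, and \<open>p\<close> those
  of the selected ones. The product \<open>?Z\<close> is common to all \<open>A\<close>.\<close>

lemma tableau_coeff_identity:
  assumes part: "is_partition lam n" and S: "S \<in> SYT lam" and B: "B \<subseteq> {1..<n}" and DB: "Des lam S \<subseteq> B"
  shows "(\<Sum>A | Des lam S \<subseteq> A \<and> A \<subseteq> B. expansion_coeff lam S A * G_coeff A B) = P_coeff lam S B"
proof -
  let ?D = "Des lam S" and ?wt = "\<lambda>j. wt lam S (cell_of lam S (j + 1))"
  let ?E = "\<lambda>j. cell_of lam S (j + 1) \<in> espec lam S"
  let ?F = "{j \<in> {1..<n}. cell_of lam S (j + 1) \<in> spec lam - espec lam S}"
  let ?Z = "\<Prod>j\<in>?F. 1 - tvar ^ ?wt j"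
  have sum: "sum_list lam = n" using part by (simp add: is_partition_def)
  have finB: "finite B" using B finite_subset by blast
  \<comment> \<open>A cell of \<open>espec\<close> never follows a descent, so at a descent
    \<open>p\<close> and \<open>q\<close> both take the value 1.\<close>
  have ED: "j \<notin> ?D" if "j \<in> {1..<n}" "?E j" for j
  proof -
    have "cell_of lam S (j + 1) \<in> spec lam" using that(2) by (simp add: espec_def)
    from espec_iff[OF part S this] that S_cell_of[OF part S, of "j + 1"] show ?thesis by simp
  qed
  \<comment> \<open>The value 0 at descents forces them into \<open>A\<close>, so the sum over
    \<open>Pow B\<close> reduces to the sets containing \<open>?D\<close>.\<close>
  define r where "r c m = (if c \<in> ?D then 0 else 1 - tvar ^ Suc m)" for c m
  define p where "p a m = (if ?E a then tvar ^ m - tvar ^ ?wt a else if a \<in> ?D then 1 else tvar ^ m)" for a m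
  define q where "q b = (if ?E b then 1 - tvar ^ ?wt b else 1)" for b
  have rpq: "r b k + p b (Suc k) = q b" if "b \<in> B" for b k
    using ED[of b] that B by (auto simp: r_def p_def q_def)
  have tele: "(\<Sum>A\<in>Pow B. (\<Prod>c\<in>B - A. r c (upto_card A c)) * (\<Prod>a\<in>A. p a (upto_card A a))) =
      (\<Prod>b\<in>B. q b)"
    using sum_subsets_telescope[OF finB, of r p q 0] rpq by simp
  have "(\<Prod>b\<in>B. q b) = (\<Prod>j\<in>{j \<in> B. ?E j}. 1 - tvar ^ ?wt j)"
    unfolding q_def by (rule prod.inter_filter[OF finB, symmetric])
  then have "P_coeff lam S B = ?Z * (\<Prod>b\<in>B. q b)" by (simp add: P_coeff_def sum)
  also have "\<dots> = (\<Sum>A\<in>Pow B. ?Z * ((\<Prod>c\<in>B - A. r c (upto_card A c)) * (\<Prod>a\<in>A. p a (upto_card A a))))"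
    by (simp only: tele[symmetric] sum_distrib_left)
  also have "\<dots> = (\<Sum>A | ?D \<subseteq> A \<and> A \<subseteq> B. expansion_coeff lam S A * G_coeff A B)"
  proof (rule sum.mono_neutral_cong_right)
    show "finite (Pow B)" using finB by simp
    show "{A. ?D \<subseteq> A \<and> A \<subseteq> B} \<subseteq> Pow B" by auto
    show "\<forall>A\<in>Pow B - {A. ?D \<subseteq> A \<and> A \<subseteq> B}.
        ?Z * ((\<Prod>c\<in>B - A. r c (upto_card A c)) * (\<Prod>a\<in>A. p a (upto_card A a))) = 0"
    proof
      fix A assume "A \<in> Pow B - {A. ?D \<subseteq> A \<and> A \<subseteq> B}"
      then obtain d where "d \<in> ?D" "d \<in> B - A" using DB by auto
      then have "(\<Prod>c\<in>B - A. r c (upto_card A c)) = 0"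
        using finB by (intro prod_zero) (auto simp: r_def)
      then show "?Z * ((\<Prod>c\<in>B - A. r c (upto_card A c)) * (\<Prod>a\<in>A. p a (upto_card A a))) = 0" by simp
    qed
  next
    fix A assume "A \<in> {A. ?D \<subseteq> A \<and> A \<subseteq> B}"
    then have A: "?D \<subseteq> A" "A \<subseteq> B" by auto
    have finA: "finite A" using A finB finite_subset by blast
    have R: "(\<Prod>c\<in>B - A. r c (upto_card A c)) = G_coeff A B"
      unfolding G_coeff_def using A by (auto simp: r_def intro!: prod.cong)
    let ?m = "\<lambda>j. if j \<in> A - ?D then upto_card A j else 0"
    \<comment> \<open>Positions outside \<open>A\<close> have exponent 0. An element of
      \<open>A\<close> followed by a cell of the first column is a descent by
      \<open>Des_if_not_spec\<close> and contributes 1. So the two index sets give the same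
      product.\<close>
    have F: "(\<Prod>j\<in>?F. tvar ^ ?m j) = (\<Prod>a\<in>{a \<in> A. \<not> ?E a}. if a \<in> ?D then 1 else tvar ^ upto_card A a)"
    proof (rule prod.mono_neutral_cong)
      show "finite {a \<in> A. \<not> ?E a}" using finA by simp
      show "(if a \<in> ?D then 1 else tvar ^ upto_card A a) = 1" if a: "a \<in> {a \<in> A. \<not> ?E a} - ?F" for a
      proof -
        have "a \<in> {1..<n}" using a A B by auto
        with a have "a \<in> ?D" by (intro Des_if_not_spec[OF part S]) auto
        then show ?thesis by simp
      qed
    qed auto
    have "(\<Prod>a\<in>A. p a (upto_card A a)) = (\<Prod>a\<in>{a \<in> A. ?E a} \<union> {a \<in> A. \<not> ?E a}. p a (upto_card A a))"
      by (intro prod.cong) auto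
    also have "\<dots> = (\<Prod>a\<in>{a \<in> A. ?E a}. p a (upto_card A a)) * (\<Prod>a\<in>{a \<in> A. \<not> ?E a}. p a (upto_card A a))"
      using finA by (intro prod.union_disjoint) auto
    also have "(\<Prod>a\<in>{a \<in> A. ?E a}. p a (upto_card A a)) =
        (\<Prod>j\<in>{a \<in> A. ?E a}. tvar ^ upto_card A j - tvar ^ ?wt j)"
      by (intro prod.cong) (auto simp: p_def)
    also have "(\<Prod>a\<in>{a \<in> A. \<not> ?E a}. p a (upto_card A a)) = (\<Prod>j\<in>?F. tvar ^ ?m j)"
      unfolding F by (intro prod.cong) (auto simp: p_def)
    finally show "?Z * ((\<Prod>c\<in>B - A. r c (upto_card A c)) * (\<Prod>a\<in>A. p a (upto_card A a))) =
        expansion_coeff lam S A * G_coeff A B"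
      unfolding R expansion_coeff_def sum prod.distrib by (simp only: mult_ac)
  qed
  finally show ?thesis ..
qed

text \<open>Both sides are expanded in words. For a word with ascent set \<open>B\<close>,
  exchanging the sums over \<open>A\<close> and \<open>S\<close> leaves
  \<open>tableau_coeff_identity\<close> for each \<open>S\<close>.\<close>

lemma hall_littlewood_P_eq_sum_hivert_G:
  assumes part: "is_partition lam n"
  shows "hall_littlewood_P N lam = (\<Sum>gamma\<in>compositions n.
    mscale (\<Sum>S | S \<in> SYT lam \<and> Des lam S \<subseteq> sub gamma. expansion_coeff lam S (sub gamma)) (hivert_G N gamma))"
proof -
  let ?K = "\<lambda>A. \<Sum>S | S \<in> SYT lam \<and> Des lam S \<subseteq> A. expansion_coeff lam S A"
  have coeff: "(\<Sum>gamma\<in>compositions n. ?K (sub gamma) * G_coeff (sub gamma) B) =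
      (\<Sum>S | S \<in> SYT lam \<and> Des lam S \<subseteq> B. P_coeff lam S B)" if B: "B \<subseteq> {1..<n}" for B
  proof -
    have finB: "finite B" using B finite_subset by blast
    have "(\<Sum>gamma\<in>compositions n. ?K (sub gamma) * G_coeff (sub gamma) B) =
        (\<Sum>A\<in>Pow {1..<n}. ?K A * G_coeff A B)"
      by (rule sum.reindex_bij_betw[OF bij_betw_sub])
    also have "\<dots> = (\<Sum>A\<in>Pow B. ?K A * G_coeff A B)"
      by (rule sum.mono_neutral_right) (use B in \<open>auto simp: G_coeff_def\<close>)
    also have "\<dots> = (\<Sum>A\<in>Pow B. \<Sum>S\<in>{S \<in> SYT lam. Des lam S \<subseteq> A}. expansion_coeff lam S A * G_coeff A B)"
      by (simp add: sum_distrib_right)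
    also have "\<dots> = (\<Sum>S\<in>SYT lam. \<Sum>A\<in>{A \<in> Pow B. Des lam S \<subseteq> A}. expansion_coeff lam S A * G_coeff A B)"
      by (rule sum.swap_restrict) (use finB in auto)
    also have "\<dots> = (\<Sum>S\<in>SYT lam. if Des lam S \<subseteq> B then P_coeff lam S B else 0)"
    proof (intro sum.cong refl)
      fix S assume S: "S \<in> SYT lam"
      have eq: "{A \<in> Pow B. Des lam S \<subseteq> A} = {A. Des lam S \<subseteq> A \<and> A \<subseteq> B}" by auto
      show "(\<Sum>A\<in>{A \<in> Pow B. Des lam S \<subseteq> A}. expansion_coeff lam S A * G_coeff A B) =
          (if Des lam S \<subseteq> B then P_coeff lam S B else 0)"
      proof (cases "Des lam S \<subseteq> B")
        case True
        then show ?thesis using tableau_coeff_identity[OF part S B True] unfolding eq by simp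
      next
        case False
        then have "{A. Des lam S \<subseteq> A \<and> A \<subseteq> B} = {}" by auto
        then show ?thesis using False unfolding eq by (simp only: sum.empty if_False)
      qed
    qed
    finally show ?thesis by (simp add: sum.inter_filter)
  qed
  have "(\<Sum>gamma\<in>compositions n. mscale (?K (sub gamma)) (hivert_G N gamma)) =
      (\<Sum>gamma\<in>compositions n. \<Sum>w\<in>words N n.
        mscale (?K (sub gamma) * G_coeff (sub gamma) (ascents w)) (word_monom w))"
    by (intro sum.cong refl) (simp only: hivert_G_words mpoly_t.scale_sum_right mpoly_t.scale_scale)
  also have "\<dots> = (\<Sum>w\<in>words N n. mscale
      (\<Sum>gamma\<in>compositions n. ?K (sub gamma) * G_coeff (sub gamma) (ascents w)) (word_monom w))"
    by (subst sum.swap) (simp only: mpoly_t.scale_sum_left)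
  also have "\<dots> = hall_littlewood_P N lam"
    unfolding hall_littlewood_P_words[OF part]
    by (intro sum.cong refl arg_cong2[where f = mscale] coeff ascents_subset)
  finally show ?thesis ..
qed

text \<open>\<open>representation\<close> is the zero function unless the set is independent and the
  vector lies in its span. The first three conjuncts exclude this default and make
  \<open>beta\<close> identify a single basis element.\<close>

theorem theorem5p3:
  fixes lam beta :: "nat list" and n N :: nat
  assumes "is_partition lam n"
    and "beta \<in> compositions n"
    and "n \<le> N"
  shows "inj_on (hivert_G N) (compositions n) \<and>
    mpoly_t.independent (hivert_G N ` compositions n) \<and>
    hall_littlewood_P N lam \<in> mpoly_t.span (hivert_G N ` compositions n) \<and>
    mpoly_t.representation (hivert_G N ` compositions n) (hall_littlewood_P N lam)
        (hivert_G N beta) =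
      (\<Sum>S\<in>{S \<in> SYT lam. Des lam S \<subseteq> sub beta}.
         (\<Prod>j\<in>{j \<in> sub beta. cell_of lam S (j + 1) \<in> espec lam S}.
            tvar ^ mj beta j - tvar ^ wt lam S (cell_of lam S (j + 1))) *
         (\<Prod>j\<in>{j \<in> {1..<n}. cell_of lam S (j + 1) \<in> spec lam - espec lam S}.
            tvar ^ mj' beta lam S j * (1 - tvar ^ wt lam S (cell_of lam S (j + 1)))))"
proof -
  note rep = representation_hivert_G[OF assms(3) hall_littlewood_P_eq_sum_hivert_G[OF assms(1)]]
  have "sum_list lam = n" using assms(1) by (simp add: is_partition_def)
  then have "mpoly_t.representation (hivert_G N ` compositions n) (hall_littlewood_P N lam) (hivert_G N beta) =
      (\<Sum>S\<in>{S \<in> SYT lam. Des lam S \<subseteq> sub beta}.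
         (\<Prod>j\<in>{j \<in> sub beta. cell_of lam S (j + 1) \<in> espec lam S}.
            tvar ^ mj beta j - tvar ^ wt lam S (cell_of lam S (j + 1))) *
         (\<Prod>j\<in>{j \<in> {1..<n}. cell_of lam S (j + 1) \<in> spec lam - espec lam S}.
            tvar ^ mj' beta lam S j * (1 - tvar ^ wt lam S (cell_of lam S (j + 1)))))"
    unfolding rep(2)[OF assms(2)] expansion_coeff_def mj'_def mj_eq by simp
  then show ?thesis
    using inj_on_hivert_G[OF assms(3)] independent_hivert_G[OF assms(3)] rep(1) by blast
qed

end
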